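(* Let $\Bbbk$ be a field of characteristic zero and $a\in\Bbbk$. Assume either that $n\geq 2$, or that $n=1$ and $a\neq0$. The $d$-graded automorphisms of $R(n,a)$ are of the form $\xi_\lambda \phi_c$, for some $\lambda\in\Bbbk^\times$ and $c\in\Bbbk$. In particular $\operatorname{Aut}_{\mathrm{gr}}R(n,a)\cong\Bbbk^\times\times\Bbbk$.
   Context: Let $A=\Bbbk[X_0,\dots,X_n]$ be the commutative polynomial ring, $\partial_i=\partial/\partial X_i$, and define the derivations $\Delta=\sum_{i=1}^{n}X_{i-1}\partial_i$ and $\Gamma_a=\sum_{i=0}^n (a+i)X_i\partial_i$ of $A$. For $k\in\mathbb{N}$ put $\binom{\Gamma_a}{k}=\frac{1}{k!}\Gamma_a(\Gamma_a-1)\cdots(\Gamma_a-(k-1))$. Then $R(n,a)$ is the associative $\Bbbk$-algebra with underlying vector space $A$ and multiplication $f\ast g=\sum_{k\ge 0}\Delta^k(f)\binom{\Gamma_a}{k}(g)$. The $d$-grading on $R(n,a)$ is the usual polynomial degree, $d(X_i)=1$ for all $i$; $R(n,a)$ is generated by $X_0,\dots,X_n$. $\operatorname{Aut}_{\mathrm{gr}}R(n,a)$ is the group of $d$-graded $\Bbbk$-algebra automorphisms of $R(n,a)$. Here $\xi_\lambda$ ($\lambda\in\Bbbk^\times$) is the automorphism with $\xi_\lambda(X_i)=\lambda X_i$ for all $i$, and $\phi_c$ ($c\in\Bbbk$) is the graded algebra automorphism of $R(n,a)$ determined by $\phi_c(X_i)=\sum_{\ell=0}^{i}\binom{c}{\ell}X_{i-\ell}$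 for $0\le i\le n$. In $\Bbbk^\times\times\Bbbk$ the second factor is the additive group. *)

theory Defs
  imports "HOL-Algebra.Bij" "HOL-Algebra.Module" "HOL-Library.Poly_Mapping"
begin

text \<open>
  Polynomials in variables indexed by the naturals are finitely supported functions from exponent
  vectors to coefficients; the library multiplication on this type is the convolution product, that
  is, the usual commutative product of polynomials.  The ring in the variables with indices
  \<open>0, \<dots>, n\<close> is the subset \<open>polys n\<close>.
\<close>

type_synonym 'k mpoly = "(nat \<Rightarrow>\<^sub>0 nat) \<Rightarrow>\<^sub>0 'k"

definition polys :: "nat \<Rightarrow> 'k::zero mpoly set" where
  "polys n = {f. \<forall>m \<in> Poly_Mapping.keys f. Poly_Mapping.keys m \<subseteq> {0..n}}"

definition Cst :: "'k::zero \<Rightarrow> 'k mpoly" where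
  "Cst c = Poly_Mapping.single 0 c"

definition X :: "nat \<Rightarrow> 'k::zero_neq_one mpoly" where
  "X i = Poly_Mapping.single (Poly_Mapping.single i 1) 1"

definition mdeg :: "(nat \<Rightarrow>\<^sub>0 nat) \<Rightarrow> nat" where
  "mdeg m = (\<Sum>i \<in> Poly_Mapping.keys m. Poly_Mapping.lookup m i)"

definition homogeneous :: "nat \<Rightarrow> nat \<Rightarrow> 'k::zero mpoly set" where
  "homogeneous n d = {f \<in> polys n. \<forall>m \<in> Poly_Mapping.keys f. mdeg m = d}"

text \<open>
  Subtraction of exponents is truncated, but a monomial not involving the variable \<open>i\<close> contributes
  the coefficient \<open>0\<close>.
\<close>

definition pdiff :: "nat \<Rightarrow> 'k::comm_ring_1 mpoly \<Rightarrow> 'k mpoly" where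
  "pdiff i f = (\<Sum>m \<in> Poly_Mapping.keys f.
     Poly_Mapping.single (m - Poly_Mapping.single i 1)
       (of_nat (Poly_Mapping.lookup m i) * Poly_Mapping.lookup f m))"

definition Delta :: "nat \<Rightarrow> 'k::comm_ring_1 mpoly \<Rightarrow> 'k mpoly" where
  "Delta n f = (\<Sum>i = 1..n. X (i - 1) * pdiff i f)"

definition Gam :: "nat \<Rightarrow> 'k::comm_ring_1 \<Rightarrow> 'k mpoly \<Rightarrow> 'k mpoly" where
  "Gam n a f = (\<Sum>i = 0..n. Cst (a + of_nat i) * X i * pdiff i f)"

text \<open>The operator \<open>T (T - 1) \<cdots> (T - (k - 1))\<close>; its factors commute.\<close>

primrec op_ffact :: "('k::comm_ring_1 mpoly \<Rightarrow> 'k mpoly) \<Rightarrow> nat \<Rightarrow> 'k mpoly \<Rightarrow> 'k mpoly" where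
  "op_ffact T 0 g = g"
| "op_ffact T (Suc k) g = op_ffact T k (T g - of_nat k * g)"

definition op_choose :: "('k::field_char_0 mpoly \<Rightarrow> 'k mpoly) \<Rightarrow> nat \<Rightarrow> 'k mpoly \<Rightarrow> 'k mpoly" where
  "op_choose T k g = Cst (1 / fact k) * op_ffact T k g"

text \<open>
  \<open>Delta n\<close> is locally nilpotent, since it lowers the weight that gives the variable \<open>i\<close> the
  weight \<open>i\<close>.  Hence only finitely many terms of the sum are nonzero, as \<open>Sum_any\<close> requires.
\<close>

definition star :: "nat \<Rightarrow> 'k::field_char_0 \<Rightarrow> 'k mpoly \<Rightarrow> 'k mpoly \<Rightarrow> 'k mpoly" where
  "star n a f g = Sum_any (\<lambda>k. (Delta n ^^ k) f * op_choose (Gam n a) k g)"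

definition R :: "nat \<Rightarrow> 'k::field_char_0 \<Rightarrow> ('k, 'k mpoly) module" where
  "R n a = \<lparr>carrier = polys n, mult = star n a, one = 1, zero = 0, add = (+),
            smult = (\<lambda>c f. Cst c * f)\<rparr>"

text \<open>
  As in the library's \<open>AutoGroup\<close>, automorphisms are extensional functions on the carrier, and the
  group law is composition.
\<close>

definition graded_auto :: "nat \<Rightarrow> 'k::field_char_0 \<Rightarrow> ('k mpoly \<Rightarrow> 'k mpoly) set" where
  "graded_auto n a =
     {\<sigma> \<in> ring_hom (R n a) (R n a) \<inter> Bij (carrier (R n a)).
        (\<forall>c. \<forall>f \<in> carrier (R n a). \<sigma> (c \<odot>\<^bsub>R n a\<^esub> f) = c \<odot>\<^bsub>R n a\<^esub> \<sigma> f) \<and>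
        (\<forall>d. \<sigma> ` homogeneous n d \<subseteq> homogeneous n d)}"

definition Aut_gr :: "nat \<Rightarrow> 'k::field_char_0 \<Rightarrow> ('k mpoly \<Rightarrow> 'k mpoly) monoid" where
  "Aut_gr n a = BijGroup (carrier (R n a)) \<lparr>carrier := graded_auto n a\<rparr>"

text \<open>
  The automorphisms \<open>\<xi>\<close> and \<open>\<phi>\<close> are determined by their values on the variables, which generate
  the algebra.  They exist for every nonzero \<open>l\<close> and every \<open>c\<close>:  the multiplication preserves the
  degree, and \<open>\<phi>\<close> is the power \<open>(1 + \<Delta>)\<^sup>c\<close>, where \<open>1 + \<Delta>\<close> is an automorphism.
\<close>

definition xi :: "nat \<Rightarrow> 'k::field_char_0 \<Rightarrow> 'k \<Rightarrow> 'k mpoly \<Rightarrow> 'k mpoly" where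
  "xi n a l = (THE \<sigma>. \<sigma> \<in> graded_auto n a \<and> (\<forall>i \<le> n. \<sigma> (X i) = Cst l * X i))"

definition phi :: "nat \<Rightarrow> 'k::field_char_0 \<Rightarrow> 'k \<Rightarrow> 'k mpoly \<Rightarrow> 'k mpoly" where
  "phi n a c = (THE \<sigma>. \<sigma> \<in> graded_auto n a \<and>
     (\<forall>i \<le> n. \<sigma> (X i) = (\<Sum>l = 0..i. Cst (c gchoose l) * X (i - l))))"

definition mult_group :: "'k::field monoid" where
  "mult_group = \<lparr>carrier = {x. x \<noteq> 0}, mult = (*), one = 1\<rparr>"

definition add_group :: "'k::field monoid" where
  "add_group = \<lparr>carrier = UNIV, mult = (+), one = 0\<rparr>"

end

theory Submission
  imports Defs "HOL-Computational_Algebra.Polynomial"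
begin

text \<open>
  If \<open>g\<close> has weight \<open>w\<close> for \<open>\<Gamma>\<close>, then \<open>f * g = (1 + \<Delta>)\<^sup>w(f) g\<close>.  From this and the Leibniz rule, \<open>1 + \<Delta>\<close> is
  multiplicative for the product \<open>*\<close>, hence so are its powers \<open>(1 + \<Delta>)\<^sup>c\<close>, first for natural \<open>c\<close> and then
  for all \<open>c\<close>, because the coefficients on both sides are polynomials in \<open>c\<close>.

  Conversely, a graded automorphism maps \<open>X 0\<close> to a normal linear form, and comparing top coefficients
  shows that these are the multiples of \<open>X 0\<close>.  The same argument modulo \<open>X 0\<close> (needed when
  \<open>a = 0\<close>) or commutation with \<open>(1 + \<Delta>)\<^sup>a\<close> (when \<open>a \<noteq> 0\<close>) controls the image of \<open>X 1\<close>, so after composing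
  with some \<open>\<xi>\<close> and \<open>\<phi>\<close> both variables are fixed.  The relations \<open>v * X 1 + X 0 * \<Gamma> u = X 1 * u\<close> with
  \<open>u = (1 + \<Delta>)\<^bsup>a + 1\<^esup> v\<close> then force all the other variables to be fixed as well.
\<close>

subsection \<open>Derivations on polynomials\<close>

text \<open>An automorphism respects the star product and not the commutative one, so all
  information about it must come from star relations among linear forms. The relations used have
  degree two, and since a right factor \<open>X j\<close> has weight \<open>a + j\<close>, each
  becomes a scalar identity between coefficients of linear forms, on which
  \<open>(1 + Delta)^c\<close> acts as a unipotent triangular matrix. The split on \<open>a\<close>
  comes from the weight of \<open>X 0\<close>. For \<open>a = 0\<close> the variable
  \<open>X 0\<close> is central and the top coefficient argument gives nothing for it, so its image
  is pinned by commuting with \<open>X 1\<close> and \<open>X 2\<close>, and the argument moves up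
  to \<open>X 1\<close>, which has weight 1. Then \<open>X 0\<close> and \<open>X 1\<close> commute,
  so no relation between them sees the scale of \<open>X 1\<close>; a relation with
  \<open>X 2\<close> does. For \<open>n = 1\<close> and \<open>a = 0\<close> the algebra is a
  commutative polynomial ring in two variables with graded automorphism group GL_2, which explains
  the hypothesis.\<close>

abbreviation keys where "keys \<equiv> Poly_Mapping.keys"
abbreviation lookup where "lookup \<equiv> Poly_Mapping.lookup"
abbreviation single where "single \<equiv> Poly_Mapping.single"
abbreviation var :: "nat \<Rightarrow> nat \<Rightarrow>\<^sub>0 nat" where "var i \<equiv> Poly_Mapping.single i (Suc 0)"

lemma sum_single_lookup: "(\<Sum>m\<in>keys f. single m (lookup f m)) = f"
  by (rule poly_mapping_eqI) (simp add: lookup_sum lookup_single when_def sum.delta in_keys_iff)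

text \<open>The set \<open>M\<close> of admissible exponents lets one induction serve
  \<open>polys n\<close>, \<open>homogeneous n d\<close> and every set closed under the index shifts
  of \<open>Delta\<close>.\<close>

lemma poly_mapping_span_induct [consumes 1, case_names zero add single]:
  fixes f :: "'a \<Rightarrow>\<^sub>0 'b::comm_monoid_add"
  assumes "keys f \<subseteq> M"
    and "P 0"
    and "\<And>f g. keys f \<subseteq> M \<Longrightarrow> keys g \<subseteq> M \<Longrightarrow> P f \<Longrightarrow> P g \<Longrightarrow> P (f + g)"
    and "\<And>m c. m \<in> M \<Longrightarrow> P (single m c)"
  shows "P f"
proof -
  have "keys (\<Sum>m\<in>A. single m (lookup f m)) \<subseteq> M \<and> P (\<Sum>m\<in>A. single m (lookup f m))"
    if "finite A" "A \<subseteq> M" for A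
    using that
  proof (induction A rule: finite_induct)
    case (insert x A)
    then have "keys (single x (lookup f x)) \<subseteq> M" "P (single x (lookup f x))"
      using assms(4) by auto
    with insert show ?case
      using assms(3) keys_add[of "single x (lookup f x)" "\<Sum>m\<in>A. single m (lookup f m)"] by auto
  qed (use assms(2) in auto)
  from this[of "keys f"] assms(1) show ?thesis
    by (simp add: sum_single_lookup)
qed

lemma poly_mapping_add_induct [case_names zero add single]:
  fixes f :: "'a \<Rightarrow>\<^sub>0 'b::comm_monoid_add"
  assumes "P 0" "\<And>f g. P f \<Longrightarrow> P g \<Longrightarrow> P (f + g)" "\<And>m c. P (single m c)"
  shows "P f"
  by (rule poly_mapping_span_induct[of f UNIV]) (use assms in auto)

lemma lookup_Cst_mult [simp]: "lookup (Cst c * f) m = c * lookup f m"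
  by (simp add: Cst_def mult_map_scale_conv_mult[symmetric] Poly_Mapping.map.rep_eq when_def)

lemma Cst_simps [simp]:
  "Cst 0 = 0" "Cst (1 :: 'k::comm_ring_1) = 1"
  "Cst c * Cst (d :: 'k::comm_ring_1) = Cst (c * d)"
  by (simp_all add: Cst_def mult_single)

lemma Cst_add: "Cst (c + d) = Cst c + Cst (d :: 'k::comm_ring_1)"
  by (simp add: Cst_def single_add)

lemma Cst_diff: "Cst (c - d) = Cst c - Cst (d :: 'k::comm_ring_1)"
  by (simp add: Cst_def single_diff)

lemma Cst_uminus: "Cst (- c) = - Cst (c :: 'k::comm_ring_1)"
  by (simp add: Cst_def single_uminus)

lemma Cst_of_nat: "Cst (of_nat k) = (of_nat k :: 'k::comm_ring_1 mpoly)"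
  by (simp add: Cst_def)

lemma Cst_mult_Cst_mult [simp]: "Cst c * (Cst d * f) = Cst (c * d) * (f :: 'k::comm_ring_1 mpoly)"
  by (simp add: mult.assoc[symmetric])

lemma Cst_mult_single [simp]: "Cst c * single m d = single m (c * d :: 'k::comm_ring_1)"
  by (simp add: Cst_def mult_single)

lemma pdiff_add: "pdiff i (f + g) = pdiff i f + pdiff i g"
  unfolding pdiff_def
  by (rule setsum_keys_plus_distrib) (simp_all add: single_add distrib_left)

lemma pdiff_zero [simp]: "pdiff i 0 = 0"
  by (simp add: pdiff_def)

lemma pdiff_single: "pdiff i (single m c) = single (m - var i) (of_nat (lookup m i) * c)"
  by (simp add: pdiff_def)

lemma minus_var_add: "lookup m i \<noteq> 0 \<Longrightarrow> m - var i + var i = m"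
  by (intro poly_mapping_eqI) (auto simp: lookup_add lookup_minus lookup_single when_def)

lemma pdiff_mult_single:
  "pdiff i (single m c * single m' c')
    = pdiff i (single m c) * single m' c' + single m c * pdiff i (single m' c')"
proof -
  have *: "(m - var i) + m' = m + m' - var i" if "lookup m i \<noteq> 0" for m m' :: "nat \<Rightarrow>\<^sub>0 nat"
    using that by (intro poly_mapping_eqI) (auto simp: lookup_add lookup_minus lookup_single when_def)
  \<comment> \<open>Truncated subtraction can make the exponents differ only when the variable is
    absent, and then the coefficient is zero.\<close>
  have "single ((m - var i) + m') (of_nat (lookup m i) * c * c')
      = single (m + m' - var i) (of_nat (lookup m i) * c * c')"
    using *[of m m'] by (cases "lookup m i = 0") simp_all
  moreover have "single (m + (m' - var i)) (c * (of_nat (lookup m' i) * c'))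
      = single (m + m' - var i) (c * (of_nat (lookup m' i) * c'))"
    using *[of m' m] by (cases "lookup m' i = 0") (simp_all add: add.commute)
  ultimately show ?thesis
    by (simp add: pdiff_single mult_single lookup_add single_add[symmetric] algebra_simps)
qed

lemma pdiff_mult: "pdiff i (f * g) = pdiff i f * g + f * pdiff i g"
proof (induction f rule: poly_mapping_add_induct)
  case (single m c)
  show ?case
    by (induction g rule: poly_mapping_add_induct)
      (simp_all add: pdiff_add distrib_left pdiff_mult_single add_ac)
qed (simp_all add: pdiff_add distrib_right add_ac)

lemma Delta_add: "Delta n (f + g) = Delta n f + Delta n g"
  by (simp add: Delta_def pdiff_add distrib_left sum.distrib)

lemma Delta_zero [simp]: "Delta n 0 = 0"
  by (simp add: Delta_def)

lemma Delta_mult: "Delta n (f * g) = Delta n f * g + f * Delta n g"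
  by (simp add: Delta_def pdiff_mult sum.distrib sum_distrib_left sum_distrib_right algebra_simps)

lemma Delta_Cst [simp]: "Delta n (Cst c) = 0"
  by (simp add: Delta_def Cst_def pdiff_single)

lemma Delta_one [simp]: "Delta n 1 = 0"
  using Delta_Cst[of n 1] by simp

lemma Delta_Cst_mult: "Delta n (Cst c * f) = Cst c * Delta n f"
  by (simp add: Delta_mult)

lemma Delta_single:
  "Delta n (single m c)
    = (\<Sum>i=1..n. single (m - var i + var (i - 1)) (of_nat (lookup m i) * c))"
  by (simp add: Delta_def X_def pdiff_single mult_single add.commute)

lemma Gam_add: "Gam n a (f + g) = Gam n a f + Gam n a g"
  by (simp add: Gam_def pdiff_add distrib_left sum.distrib)

lemma Gam_zero [simp]: "Gam n a 0 = 0"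
  by (simp add: Gam_def)

lemma Gam_Cst_mult: "Gam n a (Cst c * f) = Cst c * Gam n a f"
  by (simp add: Gam_def pdiff_mult pdiff_single[of _ 0] Cst_def[of c] sum_distrib_left mult.left_commute)

text \<open>The eigenvalue of \<open>Gam n a\<close> on a monomial. At \<open>a = 0\<close> over the
  integers it is the index sum that measures the nilpotence of \<open>Delta\<close>.\<close>

definition mwt :: "nat \<Rightarrow> 'k::comm_ring_1 \<Rightarrow> (nat \<Rightarrow>\<^sub>0 nat) \<Rightarrow> 'k" where
  "mwt n a m = (\<Sum>i=0..n. (a + of_nat i) * of_nat (lookup m i))"

lemma Gam_single:
  fixes a :: "'k::comm_ring_1"
  shows "Gam n a (single m c) = Cst (mwt n a m) * single m c"
proof -
  have that: "single (m - var i + var i) (of_nat (lookup m i) * x) = single m (of_nat (lookup m i) * x)"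
    for i and x :: 'k
  proof (cases "lookup m i = 0")
    case False
    then show ?thesis
      using minus_var_add[of m i] by simp
  qed simp
  have "Cst (a + of_nat i) * X i * pdiff i (single m c)
      = single m ((a + of_nat i) * of_nat (lookup m i) * c)" for i
    using that[of i "(a + of_nat i) * c"]
    by (simp add: X_def pdiff_single mult_single add.commute mult_ac)
  then have "Gam n a (single m c) = (\<Sum>i=0..n. single m ((a + of_nat i) * of_nat (lookup m i) * c))"
    by (simp add: Gam_def)
  also have "\<dots> = single m (mwt n a m * c)"
    by (rule poly_mapping_eqI)
      (simp add: lookup_sum lookup_single when_def mwt_def sum_distrib_right)
  finally show ?thesis by simp
qed

lemma mwt_add: "mwt n a (m + m') = mwt n a m + mwt n a m'"
  by (simp add: mwt_def lookup_add algebra_simps sum.distrib)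

lemma mwt_var: "i \<le> n \<Longrightarrow> mwt n a (var i) = a + of_nat i"
  by (simp add: mwt_def lookup_single when_def if_distrib sum.delta cong: if_cong)

lemma mwt_shift:
  assumes "i \<in> {1..n}" "lookup m i \<noteq> 0"
  shows "mwt n a (m - var i + var (i - 1)) = mwt n a m - 1"
proof -
  have "m - var i + var i = m"
    by (rule minus_var_add) (rule assms(2))
  then have "mwt n a m = mwt n a (m - var i) + mwt n a (var i)"
    by (metis mwt_add)
  moreover have "i - 1 \<le> n"
    using assms by auto
  ultimately show ?thesis
    using assms mwt_var[of i n a] mwt_var[of "i - 1" n a]
    by (simp add: mwt_add of_nat_diff)
qed

text \<open>Each term of \<open>Delta\<close> replaces some \<open>X i\<close> by
  \<open>X (i - 1)\<close> and so lowers the weight by one. Hence \<open>Delta\<close> maps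
  eigenvectors of weight \<open>w\<close> to weight \<open>w - 1\<close>.\<close>

lemma Gam_Delta: "Gam n a (Delta n f) = Delta n (Gam n a f) - Delta n f"
proof (induction f rule: poly_mapping_add_induct)
  case (single m c)
  have "Gam n a (single (m - var i + var (i - 1)) (of_nat (lookup m i) * c))
     = Cst (mwt n a m - 1) * single (m - var i + var (i - 1)) (of_nat (lookup m i) * c)"
    if "i \<in> {1..n}" for i
    using that mwt_shift[of i n m a] by (cases "lookup m i = 0") (auto simp: Gam_single)
  then have "Gam n a (Delta n (single m c)) = Cst (mwt n a m - 1) * Delta n (single m c)"
    unfolding Delta_single sum_distrib_left
    by (subst sum_comp_morphism[of "Gam n a", symmetric, unfolded o_def])
      (auto simp: Gam_add simp del: Cst_mult_single intro!: sum.cong)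
  then show ?case
    by (simp add: Gam_single Delta_Cst_mult Cst_diff left_diff_distrib del: Cst_mult_single)
qed (simp_all add: Delta_add Gam_add)

section \<open>Local nilpotence of \<open>Delta\<close>\<close>

lemma Delta_pow_add: "(Delta n ^^ k) (f + g) = (Delta n ^^ k) f + (Delta n ^^ k) g"
  by (induction k) (simp_all add: Delta_add)

lemma Delta_pow_Cst_mult: "(Delta n ^^ k) (Cst c * f) = Cst c * (Delta n ^^ k) f"
  by (induction k) (simp_all add: Delta_Cst_mult)

lemma Delta_pow_zero [simp]: "(Delta n ^^ k) 0 = 0"
  by (induction k) simp_all

text \<open>The index sum is nonnegative and drops by one with every \<open>Delta\<close>. It is
  taken in the integers because weights in the field carry no order.\<close>

lemma Delta_pow_single_eq_zero:
  "mwt n (0::int) m < int N \<Longrightarrow> (Delta n ^^ N) (single m (c :: 'k::comm_ring_1)) = 0"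
proof (induction N arbitrary: m c)
  case 0
  have "mwt n (0::int) m \<ge> 0"
    by (simp add: mwt_def sum_nonneg)
  with 0 show ?case by simp
next
  case (Suc N)
  have "(Delta n ^^ N) (single (m - var i + var (i - 1)) (of_nat (lookup m i) * c)) = 0"
    if "i \<in> {1..n}" for i
    using that Suc mwt_shift[of i n m "0::int"] by (cases "lookup m i = 0") auto
  then show ?case
    unfolding funpow_Suc_right o_apply Delta_single
    by (subst sum_comp_morphism[of "Delta n ^^ N", symmetric, unfolded o_def])
      (auto simp: Delta_pow_add)
qed

lemma Delta_nilpotent: "\<exists>N. \<forall>k\<ge>N. (Delta n ^^ k) (f :: 'k::comm_ring_1 mpoly) = 0"
proof (induction f rule: poly_mapping_add_induct)
  case (add f g)
  then obtain N M where "\<forall>k\<ge>N. (Delta n ^^ k) f = 0" "\<forall>k\<ge>M. (Delta n ^^ k) g = 0"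
    by blast
  then show ?case
    by (intro exI[of _ "max N M"]) (simp add: Delta_pow_add)
next
  case (single m c)
  show ?case
    by (intro exI[of _ "Suc (nat (mwt n 0 m))"] allI impI Delta_pow_single_eq_zero) linarith
qed simp

text \<open>The power \<open>(1 + \<Delta>)\<^sup>c\<close>, given by the binomial series.\<close>

definition binpow :: "nat \<Rightarrow> 'k::field_char_0 \<Rightarrow> 'k mpoly \<Rightarrow> 'k mpoly" where
  "binpow n c f = Sum_any (\<lambda>k. Cst (c gchoose k) * (Delta n ^^ k) f)"

lemma binpow_eq_sum:
  assumes "\<And>k. k \<ge> N \<Longrightarrow> (Delta n ^^ k) f = 0"
  shows "binpow n c f = (\<Sum>k<N. Cst (c gchoose k) * (Delta n ^^ k) f)"
  unfolding binpow_def
  by (rule Sum_any.expand_superset) (use assms in \<open>auto simp: not_le[symmetric] intro: ccontr\<close>)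

lemma star_eq_sum:
  assumes "\<And>k. k \<ge> N \<Longrightarrow> (Delta n ^^ k) f = 0"
  shows "star n a f g = (\<Sum>k<N. (Delta n ^^ k) f * op_choose (Gam n a) k g)"
  unfolding star_def
  by (rule Sum_any.expand_superset) (use assms in \<open>auto simp: not_le[symmetric] intro: ccontr\<close>)

lemma Delta_nilpotent2:
  fixes f g :: "'k::comm_ring_1 mpoly"
  obtains N where "\<And>k. k \<ge> N \<Longrightarrow> (Delta n ^^ k) f = 0" "\<And>k. k \<ge> N \<Longrightarrow> (Delta n ^^ k) g = 0"
proof -
  obtain N M where "\<forall>k\<ge>N. (Delta n ^^ k) f = 0" "\<forall>k\<ge>M. (Delta n ^^ k) g = 0"
    using Delta_nilpotent by meson
  then show ?thesis
    by (intro that[of "max N M"]) simp_all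
qed

section \<open>The star product with an eigenvector of \<open>Gam\<close> on the right\<close>

lemma op_ffact_Gam_add:
  "op_ffact (Gam n a) k (f + g) = op_ffact (Gam n a) k f + op_ffact (Gam n a) k g"
proof (induction k arbitrary: f g)
  case (Suc k)
  have "Gam n a (f + g) - of_nat k * (f + g) = (Gam n a f - of_nat k * f) + (Gam n a g - of_nat k * g)"
    by (simp add: Gam_add algebra_simps)
  with Suc show ?case by simp
qed simp

lemma op_choose_Gam_add:
  "op_choose (Gam n a) k (f + g) = op_choose (Gam n a) k f + op_choose (Gam n a) k g"
  by (simp add: op_choose_def op_ffact_Gam_add distrib_left)

lemma op_ffact_Gam_eigen:
  "Gam n a g = Cst w * g \<Longrightarrow> op_ffact (Gam n a) k g = Cst (\<Prod>i=0..<k. w - of_nat i) * g"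
proof (induction k arbitrary: g)
  case (Suc k)
  have *: "Gam n a g - of_nat k * g = Cst (w - of_nat k) * g"
    by (simp add: Suc.prems Cst_diff Cst_of_nat left_diff_distrib)
  have "Gam n a (Cst (w - of_nat k) * g) = Cst w * (Cst (w - of_nat k) * g)"
    by (simp add: Gam_Cst_mult Suc.prems mult.commute[of w])
  from Suc.IH[OF this] show ?case
    by (simp add: * )
qed simp

lemma op_choose_Gam_eigen:
  "Gam n a g = Cst w * g \<Longrightarrow> op_choose (Gam n a) k g = Cst (w gchoose k) * g"
  by (simp add: op_choose_def op_ffact_Gam_eigen[where w = w] gbinomial_prod_rev)

lemma star_eigen:
  assumes "Gam n a g = Cst w * g"
  shows "star n a f g = binpow n w f * g"
proof -
  obtain N where "\<And>k. k \<ge> N \<Longrightarrow> (Delta n ^^ k) f = 0"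
    using Delta_nilpotent by meson
  then show ?thesis
    by (simp add: star_eq_sum[of N] binpow_eq_sum[of N] op_choose_Gam_eigen[OF assms]
        sum_distrib_right mult.assoc mult.left_commute)
qed

lemma star_single: "star n a f (single m c) = binpow n (mwt n a m) f * single m c"
  by (rule star_eigen) (rule Gam_single)

lemma star_add_left: "star n a (f + f') g = star n a f g + star n a f' g"
proof -
  obtain N where "\<And>k. k \<ge> N \<Longrightarrow> (Delta n ^^ k) f = 0" "\<And>k. k \<ge> N \<Longrightarrow> (Delta n ^^ k) f' = 0"
    using Delta_nilpotent2[of n f f'] by blast
  then show ?thesis
    by (simp add: star_eq_sum[of N] Delta_pow_add distrib_right sum.distrib)
qed

lemma star_add_right: "star n a f (g + g') = star n a f g + star n a f g'"
proof -
  obtain N where "\<And>k. k \<ge> N \<Longrightarrow> (Delta n ^^ k) f = 0"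
    using Delta_nilpotent by meson
  then show ?thesis
    by (simp add: star_eq_sum[of N] op_choose_Gam_add distrib_left sum.distrib)
qed

lemma binpow_add: "binpow n c (f + g) = binpow n c f + binpow n c g"
proof -
  obtain N where "\<And>k. k \<ge> N \<Longrightarrow> (Delta n ^^ k) f = 0" "\<And>k. k \<ge> N \<Longrightarrow> (Delta n ^^ k) g = 0"
    using Delta_nilpotent2[of n f g] by blast
  then show ?thesis
    by (simp add: binpow_eq_sum[of N] Delta_pow_add distrib_left sum.distrib)
qed

lemma binpow_Cst_mult: "binpow n c (Cst d * f) = Cst d * binpow n c f"
proof -
  obtain N where "\<And>k. k \<ge> N \<Longrightarrow> (Delta n ^^ k) f = 0"
    using Delta_nilpotent by meson
  then show ?thesis
    by (simp add: binpow_eq_sum[of N] Delta_pow_Cst_mult sum_distrib_left mult.commute[of d])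
qed

lemma star_zero_left [simp]: "star n a 0 g = 0"
  using star_add_left[of n a 0 0 g] by simp

lemma star_zero_right [simp]: "star n a f 0 = 0"
  using star_add_right[of n a f 0 0] by simp

lemma binpow_0 [simp]: "binpow n 0 f = f"
proof -
  obtain N where "\<And>k. k \<ge> N \<Longrightarrow> (Delta n ^^ k) f = 0"
    using Delta_nilpotent by meson
  \<comment> \<open>\<open>N\<close> may be 0; the larger bound guarantees a term
    \<open>k = 0\<close> to split off.\<close>
  then have "\<And>k. k \<ge> Suc N \<Longrightarrow> (Delta n ^^ k) f = 0"
    by simp
  from binpow_eq_sum[of "Suc N", OF this] show ?thesis
    by (simp add: sum.lessThan_Suc_shift gbinomial_0(2) del: sum.lessThan_Suc)
qed

lemma binpow_Delta: "binpow n c (Delta n f) = Delta n (binpow n c f)"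
proof -
  obtain N where "\<And>k. k \<ge> N \<Longrightarrow> (Delta n ^^ k) f = 0" "\<And>k. k \<ge> N \<Longrightarrow> (Delta n ^^ k) (Delta n f) = 0"
    using Delta_nilpotent2[of n f "Delta n f"] by blast
  then show ?thesis
    by (simp add: binpow_eq_sum[of N] funpow_swap1 Delta_Cst_mult
        sum_comp_morphism[of "Delta n", symmetric, unfolded o_def] Delta_add)
qed

text \<open>Pascal's rule. It supplies the induction step at natural exponents, from which the laws
  for arbitrary exponents are interpolated.\<close>

lemma binpow_plus_1: "binpow n (c + 1) f = binpow n c (f + Delta n f)"
proof -
  obtain N where N: "\<And>k. k \<ge> N \<Longrightarrow> (Delta n ^^ k) f = 0"
    using Delta_nilpotent by meson
  define D where "D k = (Delta n ^^ k) f" for k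
  have D: "(Delta n ^^ k) f = D k" "(Delta n ^^ k) (Delta n f) = D (Suc k)" for k
    by (simp_all add: D_def funpow_swap1)
  have D0: "D N = 0"
    using N by (simp add: D_def)
  have "binpow n (c + 1) f = (\<Sum>k<Suc N. Cst ((c + 1) gchoose k) * D k)"
    using N by (subst binpow_eq_sum[of "Suc N"]) (simp_all add: D)
  also have "\<dots> = D 0 + (\<Sum>k<N. Cst (c gchoose Suc k) * D (Suc k)) + (\<Sum>k<N. Cst (c gchoose k) * D (Suc k))"
    by (simp add: sum.lessThan_Suc_shift gbinomial_Suc_Suc Cst_add distrib_right sum.distrib
        del: sum.lessThan_Suc)
  also have "D 0 + (\<Sum>k<N. Cst (c gchoose Suc k) * D (Suc k)) = (\<Sum>k<Suc N. Cst (c gchoose k) * D k)"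
    by (simp add: sum.lessThan_Suc_shift del: sum.lessThan_Suc)
  also have "\<dots> = (\<Sum>k<N. Cst (c gchoose k) * D k)"
    by (simp add: D0)
  also have "\<dots> = binpow n c f"
    using N by (subst binpow_eq_sum[of N]) (simp_all add: D)
  also have "(\<Sum>k<N. Cst (c gchoose k) * D (Suc k)) = binpow n c (Delta n f)"
    using N[of "Suc _"] by (subst binpow_eq_sum[of N]) (simp_all add: funpow_swap1 D_def)
  finally show ?thesis
    by (simp add: binpow_add)
qed

text \<open>By additivity \<open>g\<close> is a monomial of weight \<open>w\<close>. Then
  \<open>Delta n g\<close> has weight \<open>w - 1\<close>, and the power of
  \<open>1 + Delta\<close> lost there is made up by the extra factor on \<open>f\<close>:
  \<open>(1 + Delta)^(w - 1) (f + Delta f) = (1 + Delta)^w f\<close>.\<close>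

lemma star_plus_Delta:
  "star n a f g + Delta n (star n a f g) = star n a (f + Delta n f) (g + Delta n g)"
proof (induction g rule: poly_mapping_add_induct)
  case (single m c)
  define g where "g = single m c"
  define w where "w = mwt n a m"
  have g: "Gam n a g = Cst w * g"
    by (simp only: g_def w_def Gam_single)
  have Dg: "Gam n a (Delta n g) = Cst (w - 1) * Delta n g"
    by (simp add: Gam_Delta g Delta_Cst_mult Cst_diff left_diff_distrib)
  have "binpow n (w - 1) (f + Delta n f) = binpow n w f"
    using binpow_plus_1[of n "w - 1" f] by simp
  then have "star n a (f + Delta n f) (g + Delta n g)
      = binpow n w (f + Delta n f) * g + binpow n w f * Delta n g"
    by (simp add: star_add_right star_eigen[OF g] star_eigen[OF Dg])
  then show ?case
    unfolding g_def[symmetric] star_eigen[OF g]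
    by (simp add: Delta_mult binpow_add binpow_Delta distrib_right add_ac)
qed (simp_all add: star_add_right Delta_add add_ac)

subsection \<open>Polynomial dependence on the exponent\<close>

definition polyfun :: "('k::field_char_0 \<Rightarrow> 'k) \<Rightarrow> bool" where
  "polyfun F \<longleftrightarrow> (\<exists>p. \<forall>c. F c = poly p c)"

lemma polyfun_const: "polyfun (\<lambda>_. d)"
  unfolding polyfun_def by (rule exI[of _ "[:d:]"]) simp

lemma polyfun_add: "polyfun F \<Longrightarrow> polyfun G \<Longrightarrow> polyfun (\<lambda>c. F c + G c)"
  unfolding polyfun_def by (metis poly_add)

lemma polyfun_diff: "polyfun F \<Longrightarrow> polyfun G \<Longrightarrow> polyfun (\<lambda>c. F c - G c)"
  unfolding polyfun_def by (metis poly_diff)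

lemma polyfun_mult: "polyfun F \<Longrightarrow> polyfun G \<Longrightarrow> polyfun (\<lambda>c. F c * G c)"
  unfolding polyfun_def by (metis poly_mult)

lemma polyfun_sum: "(\<And>i. i \<in> A \<Longrightarrow> polyfun (F i)) \<Longrightarrow> polyfun (\<lambda>c. \<Sum>i\<in>A. F i c)"
  by (induction A rule: infinite_finite_induct) (simp_all add: polyfun_const polyfun_add)

lemma polyfun_prod: "(\<And>i. i \<in> A \<Longrightarrow> polyfun (F i)) \<Longrightarrow> polyfun (\<lambda>c. \<Prod>i\<in>A. F i c)"
  by (induction A rule: infinite_finite_induct) (simp_all add: polyfun_const polyfun_mult)

lemma polyfun_ident: "polyfun (\<lambda>c. c)"
  unfolding polyfun_def by (rule exI[of _ "[:0, 1:]"]) simp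

lemma polyfun_gbinomial: "polyfun (\<lambda>c. (c + d) gchoose k)"
proof -
  have "polyfun (\<lambda>c. (\<Prod>i=0..<k. (c + d) - of_nat i) * (1 / fact k))"
    by (intro polyfun_mult polyfun_prod polyfun_diff polyfun_add polyfun_const polyfun_ident)
  then show ?thesis
    by (simp add: gbinomial_prod_rev)
qed

text \<open>The difference is a polynomial vanishing at all naturals, which are infinitely many in
  characteristic zero.\<close>

lemma polyfun_eqI:
  assumes "polyfun F" "polyfun G" "\<And>m. F (of_nat m) = G (of_nat m)"
  shows "F c = G c"
proof -
  obtain p where p: "\<And>c. F c - G c = poly p c"
    using polyfun_diff[OF assms(1,2)] by (auto simp: polyfun_def)
  have "range of_nat \<subseteq> {x. poly p x = 0}"
    using assms(3) by (auto simp flip: p)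
  moreover have "infinite (range (of_nat :: nat \<Rightarrow> 'a))"
    by (rule range_inj_infinite) (rule inj_of_nat)
  ultimately have "p = 0"
    using poly_roots_finite finite_subset by blast
  then show ?thesis
    using p[of c] by simp
qed

text \<open>Nilpotence makes the series a finite sum whose bound does not depend on
  \<open>c\<close>. The shift \<open>d\<close> serves the interpolation of the exponent law.\<close>

lemma polyfun_lookup_binpow: "polyfun (\<lambda>c. lookup (binpow n (c + d) f) m)"
proof -
  obtain N where "\<And>k. k \<ge> N \<Longrightarrow> (Delta n ^^ k) f = 0"
    using Delta_nilpotent by meson
  then show ?thesis
    by (simp add: binpow_eq_sum[of N] lookup_sum)
      (intro polyfun_sum polyfun_mult polyfun_gbinomial polyfun_const)
qed

lemma star_Cst_mult_left: "star n a (Cst c * f) g = Cst c * star n a f g"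
proof -
  obtain N where "\<And>k. k \<ge> N \<Longrightarrow> (Delta n ^^ k) f = 0"
    using Delta_nilpotent by meson
  then show ?thesis
    by (simp add: star_eq_sum[of N] Delta_pow_Cst_mult sum_distrib_left mult.assoc)
qed

lemma star_Cst_mult_right: "star n a f (Cst c * g) = Cst c * star n a f g"
proof (induction g rule: poly_mapping_add_induct)
  case (single m d)
  have "star n a f (Cst c * single m d) = Cst c * (binpow n (mwt n a m) f * single m d)"
    by (simp only: Cst_mult_single star_single) (simp add: mult.left_commute[of "Cst c"])
  then show ?case
    by (simp only: star_single)
qed (simp_all add: distrib_left star_add_right)

lemma star_sum_left: "star n a (\<Sum>i\<in>A. f i) g = (\<Sum>i\<in>A. star n a (f i) g)"
  by (induction A rule: infinite_finite_induct) (simp_all add: star_add_left)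

lemma star_sum_right: "star n a f (\<Sum>i\<in>A. g i) = (\<Sum>i\<in>A. star n a f (g i))"
  by (induction A rule: infinite_finite_induct) (simp_all add: star_add_right)

lemma binpow_star: "binpow n c (star n a f g) = star n a (binpow n c f) (binpow n c g)"
proof (rule poly_mapping_eqI)
  fix m
  obtain N where N: "\<And>k. k \<ge> N \<Longrightarrow> (Delta n ^^ k) f = 0" "\<And>k. k \<ge> N \<Longrightarrow> (Delta n ^^ k) g = 0"
    using Delta_nilpotent2[of n f g] by blast
  have gb: "polyfun (\<lambda>c::'a. c gchoose k)" for k
    using polyfun_gbinomial[of 0 k] by simp
  \<comment> \<open>With both series cut at \<open>N\<close>, bilinearity leaves finitely many fixed
    star products with coefficients polynomial in \<open>c\<close>.\<close>
  have 1: "polyfun (\<lambda>c. lookup (star n a (binpow n c f) (binpow n c g)) m)"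
    by (simp add: binpow_eq_sum[of N] N star_sum_left star_sum_right star_Cst_mult_left
        star_Cst_mult_right lookup_sum polyfun_sum polyfun_mult polyfun_const gb)
  have 2: "polyfun (\<lambda>c. lookup (binpow n c (star n a f g)) m)"
    using polyfun_lookup_binpow[of n 0 "star n a f g" m] by simp
  have 3: "binpow n (of_nat k) (star n a f g) = star n a (binpow n (of_nat k) f) (binpow n (of_nat k) g)"
    for k
  proof (induction k arbitrary: f g)
    case (Suc k)
    show ?case
      by (simp only: of_nat_Suc add.commute[of 1] binpow_plus_1 star_plus_Delta Suc)
  qed simp
  show "lookup (binpow n c (star n a f g)) m = lookup (star n a (binpow n c f) (binpow n c g)) m"
    by (rule polyfun_eqI[OF 2 1]) (simp only: 3)
qed

text \<open>Only the outer exponent is interpolated; \<open>d\<close> stays arbitrary. This is what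
  makes \<open>binpow n (- c)\<close> the inverse of \<open>binpow n c\<close>.\<close>

lemma binpow_binpow: "binpow n c (binpow n d f) = binpow n (c + d) f"
proof (rule poly_mapping_eqI)
  fix m
  have "binpow n (of_nat k) (binpow n d f) = binpow n (of_nat k + d) f" for k
  proof (induction k arbitrary: f)
    case (Suc k)
    have "binpow n (of_nat (Suc k)) (binpow n d f) = binpow n (of_nat k) (binpow n d (f + Delta n f))"
      using binpow_plus_1[of n "of_nat k"] by (simp add: binpow_Delta binpow_add add.commute)
    also have "\<dots> = binpow n (of_nat (Suc k) + d) f"
      using binpow_plus_1[of n "of_nat k + d" f] by (simp add: Suc add_ac)
    finally show ?case .
  qed simp
  then show "lookup (binpow n c (binpow n d f)) m = lookup (binpow n (c + d) f) m"
    using polyfun_eqI[OF polyfun_lookup_binpow[of n 0 "binpow n d f" m] polyfun_lookup_binpow[of n d f m]]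
    by simp
qed

subsection \<open>Values on the variables\<close>

lemma Delta_X: "i \<le> n \<Longrightarrow> Delta n (X i) = (if i = 0 then 0 else X (i - 1))"
proof -
  assume "i \<le> n"
  have "Delta n (X i :: 'a mpoly) = (\<Sum>j=1..n. if j = i then X (i - 1) else 0)"
    unfolding X_def Delta_single by (intro sum.cong) (auto simp: lookup_single when_def)
  with \<open>i \<le> n\<close> show ?thesis by (simp add: sum.delta)
qed

lemma Delta_pow_X: "i \<le> n \<Longrightarrow> (Delta n ^^ k) (X i) = (if k \<le> i then X (i - k) else 0)"
  by (induction k) (auto simp: Delta_X Suc_diff_le)

lemma binpow_X: "i \<le> n \<Longrightarrow> binpow n c (X i) = (\<Sum>l=0..i. Cst (c gchoose l) * X (i - l))"
  by (subst binpow_eq_sum[of "Suc i"])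
    (auto simp: Delta_pow_X lessThan_Suc_atMost atLeast0AtMost intro!: sum.cong)

lemma binpow_one [simp]: "binpow n c 1 = 1"
proof -
  have "(Delta n ^^ k) 1 = 0" if "k \<ge> Suc 0" for k
    using that by (cases k) (simp_all add: funpow_swap1[symmetric] funpow_Suc_right del: funpow.simps)
  from binpow_eq_sum[of "Suc 0", OF this] show ?thesis by simp
qed

lemma Gam_X: "i \<le> n \<Longrightarrow> Gam n a (X i) = Cst (a + of_nat i) * X i"
  using Gam_single[of n a "var i" 1] mwt_var[of i n a] by (simp add: X_def)

lemma star_X: "j \<le> n \<Longrightarrow> star n a f (X j) = binpow n (a + of_nat j) f * X j"
  by (rule star_eigen) (rule Gam_X)

lemma star_X_0_left: "star n a (X 0) g = X 0 * g"
proof -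
  have "(Delta n ^^ k) (X 0) = 0" if "k \<ge> Suc 0" for k
    using that by (simp add: Delta_pow_X)
  from star_eq_sum[of "Suc 0", OF this] show ?thesis by (simp add: op_choose_def)
qed

text \<open>The series stops after two terms, since \<open>Delta\<close> sends \<open>X 1\<close> to
  \<open>X 0\<close> and \<open>X 0\<close> to zero.\<close>

lemma star_X_1_left: "n \<ge> 1 \<Longrightarrow> star n a (X 1) g = X 1 * g + X 0 * Gam n a g"
  by (subst star_eq_sum[of 2]) (auto simp: Delta_pow_X op_choose_def numeral_2_eq_2)

subsection \<open>Graded automorphisms\<close>

lemma mdeg_add: "mdeg (m + m') = mdeg m + mdeg m'"
  unfolding mdeg_def by (rule setsum_keys_plus_distrib[where f = "\<lambda>_ x. x"]) simp_all

lemma mdeg_var [simp]: "mdeg (var i) = 1"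
  by (simp add: mdeg_def)

lemma mdeg_zero [simp]: "mdeg 0 = 0"
  by (simp add: mdeg_def)

lemma mdeg_shift: "lookup m i \<noteq> 0 \<Longrightarrow> mdeg (m - var i + var j) = mdeg m"
  by (metis mdeg_add mdeg_var minus_var_add)

lemma keys_sum_subset: "(\<And>i. i \<in> A \<Longrightarrow> keys (f i) \<subseteq> M) \<Longrightarrow> keys (\<Sum>i\<in>A. f i) \<subseteq> M"
proof (induction A rule: infinite_finite_induct)
  case (insert x A)
  then have "keys (f x) \<subseteq> M" "keys (\<Sum>i\<in>A. f i) \<subseteq> M"
    by simp_all
  then show ?case
    using keys_add[of "f x" "\<Sum>i\<in>A. f i"] insert.hyps by auto
qed simp_all

lemma keys_Cst_mult: "keys (Cst c * f) \<subseteq> keys (f :: 'k::comm_ring_1 mpoly)"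
  by (auto simp: in_keys_iff)

text \<open>\<open>M\<close> is any set of exponents stable under lowering one index, so that
  preservation of the variable range and of the degree are instances of one statement.\<close>

lemma keys_Delta_subset:
  assumes "\<And>m i. m \<in> M \<Longrightarrow> i \<in> {1..n} \<Longrightarrow> lookup m i \<noteq> 0 \<Longrightarrow> m - var i + var (i - 1) \<in> M"
    and "keys f \<subseteq> M"
  shows "keys (Delta n f) \<subseteq> M"
  using assms(2)
proof (induction f rule: poly_mapping_span_induct)
  case (add f g)
  then show ?case
    unfolding Delta_add by (intro order.trans[OF keys_add] Un_least)
next
  case (single m c)
  show ?case
    unfolding Delta_single
  proof (rule keys_sum_subset)
    fix i assume "i \<in> {1..n}"
    then show "keys (single (m - var i + var (i - 1)) (of_nat (lookup m i) * c)) \<subseteq> M"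
      using assms(1) single by (cases "lookup m i = 0") auto
  qed
qed simp

lemma keys_binpow_subset:
  assumes "\<And>m i. m \<in> M \<Longrightarrow> i \<in> {1..n} \<Longrightarrow> lookup m i \<noteq> 0 \<Longrightarrow> m - var i + var (i - 1) \<in> M"
    and "keys f \<subseteq> M"
  shows "keys (binpow n c f) \<subseteq> M"
proof -
  have *: "keys ((Delta n ^^ k) f) \<subseteq> M" for k
  proof (induction k)
    case (Suc k)
    have "keys (Delta n ((Delta n ^^ k) f)) \<subseteq> M"
      by (rule keys_Delta_subset) (use assms(1) Suc in \<open>blast+\<close>)
    then show ?case by simp
  qed (simp add: assms(2))
  obtain N where N: "\<And>k. k \<ge> N \<Longrightarrow> (Delta n ^^ k) f = 0"
    using Delta_nilpotent by meson
  have "binpow n c f = (\<Sum>k<N. Cst (c gchoose k) * (Delta n ^^ k) f)"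
    by (rule binpow_eq_sum) (rule N)
  also have "keys \<dots> \<subseteq> M"
    by (rule keys_sum_subset) (rule order.trans[OF keys_Cst_mult *])
  finally show ?thesis .
qed

lemma polys_iff: "f \<in> polys n \<longleftrightarrow> keys f \<subseteq> {m. keys m \<subseteq> {0..n}}"
  by (auto simp: polys_def)

lemma homogeneous_iff: "f \<in> homogeneous n d \<longleftrightarrow> keys f \<subseteq> {m. keys m \<subseteq> {0..n} \<and> mdeg m = d}"
  by (auto simp: homogeneous_def polys_def)

lemma homogeneous_imp_polys: "f \<in> homogeneous n d \<Longrightarrow> f \<in> polys n"
  by (simp add: homogeneous_def)

lemma keys_shift_subset:
  assumes "keys m \<subseteq> {0..n}" "Suc 0 \<le> i" "i \<le> n"
  shows "keys (m - var i + var (i - Suc 0)) \<subseteq> {0..n}"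
proof -
  have "keys (m - var i) \<subseteq> keys m"
    by (auto simp: in_keys_iff lookup_minus)
  moreover have "keys (var (i - Suc 0)) \<subseteq> {0..n}"
    using assms by simp
  ultimately show ?thesis
    using assms(1) by (intro order.trans[OF keys_add] Un_least) (rule order.trans)
qed

lemma binpow_polys: "f \<in> polys n \<Longrightarrow> binpow n c f \<in> polys n"
  unfolding polys_iff by (rule keys_binpow_subset) (simp_all add: keys_shift_subset)

lemma binpow_homogeneous: "f \<in> homogeneous n d \<Longrightarrow> binpow n c f \<in> homogeneous n d"
  unfolding homogeneous_iff
  by (rule keys_binpow_subset) (simp_all add: keys_shift_subset mdeg_shift)

lemma polys_add: "f \<in> polys n \<Longrightarrow> g \<in> polys n \<Longrightarrow> f + g \<in> polys n"
  unfolding polys_iff by (rule order.trans[OF keys_add]) simp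

lemma polys_sum: "(\<And>i. i \<in> A \<Longrightarrow> f i \<in> polys n) \<Longrightarrow> (\<Sum>i\<in>A. f i) \<in> polys n"
  unfolding polys_iff by (rule keys_sum_subset)

lemma polys_Cst_mult: "f \<in> polys n \<Longrightarrow> Cst c * f \<in> polys n" for f :: "'k::comm_ring_1 mpoly"
  unfolding polys_iff by (rule order.trans[OF keys_Cst_mult])

lemma polys_mult: "f \<in> polys n \<Longrightarrow> g \<in> polys n \<Longrightarrow> f * g \<in> polys n"
  unfolding polys_iff
  by (rule order.trans[OF keys_mult]) (auto dest!: subsetD[OF keys_add])

lemma polys_zero [simp]: "0 \<in> polys n"
  by (simp add: polys_iff)

lemma polys_one [simp]: "1 \<in> polys n"
  by (simp add: polys_iff)

lemma polys_X: "i \<le> n \<Longrightarrow> X i \<in> polys n"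
  by (auto simp: polys_iff X_def)

lemma polys_single: "keys m \<subseteq> {0..n} \<Longrightarrow> single m c \<in> polys n"
  by (auto simp: polys_iff)

lemma homogeneous_X: "i \<le> n \<Longrightarrow> X i \<in> homogeneous n 1"
  by (auto simp: homogeneous_iff X_def)

lemma homogeneous_add: "f \<in> homogeneous n d \<Longrightarrow> g \<in> homogeneous n d \<Longrightarrow> f + g \<in> homogeneous n d"
  unfolding homogeneous_iff by (rule order.trans[OF keys_add]) simp

lemma homogeneous_Cst_mult:
  "f \<in> homogeneous n d \<Longrightarrow> Cst c * f \<in> homogeneous n d" for f :: "'k::comm_ring_1 mpoly"
  unfolding homogeneous_iff by (rule order.trans[OF keys_Cst_mult])

text \<open>The commutative algebra map scaling every variable by \<open>l\<close>. It commutes with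
  \<open>Delta\<close> and preserves each monomial up to a scalar, which makes it multiplicative for
  the star product as well and a realisation of \<open>xi\<close>.\<close>

definition dilate :: "'k::comm_ring_1 \<Rightarrow> 'k mpoly \<Rightarrow> 'k mpoly" where
  "dilate l f = (\<Sum>m\<in>keys f. single m (l ^ mdeg m * lookup f m))"

lemma lookup_dilate [simp]: "lookup (dilate l f) m = l ^ mdeg m * lookup f m"
  by (simp add: dilate_def lookup_sum lookup_single when_def in_keys_iff)

lemma dilate_add: "dilate l (f + g) = dilate l f + dilate l g"
  by (rule poly_mapping_eqI) (simp add: lookup_add distrib_left)

lemma dilate_zero [simp]: "dilate l 0 = 0"
  by (rule poly_mapping_eqI) simp

lemma dilate_Cst_mult: "dilate l (Cst c * f) = Cst c * dilate l f"
  by (rule poly_mapping_eqI) (simp add: mult.left_commute)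

lemma dilate_single: "dilate l (single m c) = single m (l ^ mdeg m * c)"
  by (rule poly_mapping_eqI) (simp add: lookup_single when_def)

lemma dilate_dilate: "dilate l (dilate l' f) = dilate (l * l') f"
  by (rule poly_mapping_eqI) (simp add: power_mult_distrib mult.assoc)

lemma dilate_1 [simp]: "dilate 1 f = f"
  by (rule poly_mapping_eqI) simp

lemma dilate_one [simp]: "dilate l 1 = 1"
  using dilate_single[of l 0 1] by simp

lemma dilate_X: "dilate l (X i) = Cst l * X i"
  by (simp add: X_def dilate_single)

lemma dilate_mult: "dilate l (f * g) = dilate l f * dilate l g"
proof (induction f rule: poly_mapping_add_induct)
  case (single m c)
  show ?case
    by (induction g rule: poly_mapping_add_induct)
      (simp_all add: distrib_left distrib_right dilate_add mult_single dilate_single mdeg_add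
        power_add mult.assoc mult.left_commute)
qed (simp_all add: distrib_right dilate_add)

lemma dilate_sum: "dilate l (\<Sum>i\<in>A. f i) = (\<Sum>i\<in>A. dilate l (f i))"
  by (induction A rule: infinite_finite_induct) (simp_all add: dilate_add)

lemma dilate_Delta: "dilate l (Delta n f) = Delta n (dilate l f)"
proof (induction f rule: poly_mapping_add_induct)
  case (single m c)
  have "dilate l (single (m - var i + var (i - 1)) (of_nat (lookup m i) * c))
      = single (m - var i + var (i - 1)) (of_nat (lookup m i) * (l ^ mdeg m * c))" for i
    by (cases "lookup m i = 0") (simp_all add: dilate_single mdeg_shift mult_ac)
  then show ?case
    by (simp add: Delta_single dilate_sum dilate_single)
qed (simp_all add: Delta_add dilate_add)

lemma dilate_binpow: "dilate l (binpow n c f) = binpow n c (dilate l f)"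
proof -
  have *: "(Delta n ^^ k) (dilate l f) = dilate l ((Delta n ^^ k) f)" for k
    by (induction k) (simp_all add: dilate_Delta)
  obtain N where "\<And>k. k \<ge> N \<Longrightarrow> (Delta n ^^ k) f = 0"
    using Delta_nilpotent by meson
  then show ?thesis
    by (simp add: binpow_eq_sum[of N] * dilate_sum dilate_Cst_mult)
qed

lemma dilate_star: "dilate l (star n a f g) = star n a (dilate l f) (dilate l g)"
proof (induction g rule: poly_mapping_add_induct)
  case (single m c)
  show ?case
    by (simp add: star_single dilate_single dilate_mult dilate_binpow)
qed (simp_all add: star_add_right dilate_add)

lemma keys_dilate: "keys (dilate l f) \<subseteq> keys f"
  by (auto simp: in_keys_iff)

lemma dilate_polys: "f \<in> polys n \<Longrightarrow> dilate l f \<in> polys n"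
  unfolding polys_iff by (rule order.trans[OF keys_dilate])

lemma dilate_homogeneous: "f \<in> homogeneous n d \<Longrightarrow> dilate l f \<in> homogeneous n d"
  unfolding homogeneous_iff by (rule order.trans[OF keys_dilate])

section \<open>Graded automorphisms as maps on \<open>polys n\<close>\<close>

lemma carrier_R [simp]: "carrier (R n a) = polys n"
  by (simp add: R_def)

lemma graded_auto_iff:
  "\<sigma> \<in> graded_auto n a \<longleftrightarrow> \<sigma> \<in> Bij (polys n) \<and> \<sigma> 1 = 1
    \<and> (\<forall>f\<in>polys n. \<forall>g\<in>polys n. \<sigma> (star n a f g) = star n a (\<sigma> f) (\<sigma> g))
    \<and> (\<forall>f\<in>polys n. \<forall>g\<in>polys n. \<sigma> (f + g) = \<sigma> f + \<sigma> g)
    \<and> (\<forall>c. \<forall>f\<in>polys n. \<sigma> (Cst c * f) = Cst c * \<sigma> f)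
    \<and> (\<forall>d. \<forall>f\<in>homogeneous n d. \<sigma> f \<in> homogeneous n d)"
  unfolding graded_auto_def ring_hom_def
  by (auto simp: R_def image_subset_iff dest: Bij_imp_funcset)

lemma star_polys:
  assumes "f \<in> polys n" "g \<in> polys n"
  shows "star n a f g \<in> polys n"
  using assms(2) unfolding polys_iff[of g n]
proof (induction g rule: poly_mapping_span_induct)
  case (single m c)
  then show ?case
    by (simp add: star_single polys_mult binpow_polys polys_single assms(1))
qed (simp_all add: star_add_right polys_add)

text \<open>Elements of \<open>graded_auto\<close> are extensional, whereas \<open>dilate\<close>
  and \<open>binpow\<close> act on all polynomials; hence the restriction. \<open>T'\<close> is the
  inverse that provides bijectivity.\<close>

lemma graded_auto_restrictI:
  assumes "\<And>f. f \<in> polys n \<Longrightarrow> T f \<in> polys n" "\<And>f. f \<in> polys n \<Longrightarrow> T' f \<in> polys n"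
    and "\<And>f. T (T' f) = f" "\<And>f. T' (T f) = f"
    and "T 1 = 1" "\<And>f g. T (star n a f g) = star n a (T f) (T g)"
    and "\<And>f g. T (f + g) = T f + T g" "\<And>c f. T (Cst c * f) = Cst c * T f"
    and "\<And>f d. f \<in> homogeneous n d \<Longrightarrow> T f \<in> homogeneous n d"
  shows "restrict T (polys n) \<in> graded_auto n a"
proof -
  have "bij_betw T (polys n) (polys n)"
    by (rule bij_betw_byWitness[of _ T']) (use assms in auto)
  then have "restrict T (polys n) \<in> Bij (polys n)"
    by (simp add: Bij_def)
  then show ?thesis
    unfolding graded_auto_iff
    by (simp add: assms star_polys polys_add polys_Cst_mult homogeneous_imp_polys)
qed

lemma dilate_in_graded_auto: "l \<noteq> 0 \<Longrightarrow> restrict (dilate l) (polys n) \<in> graded_auto n a"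
  by (rule graded_auto_restrictI[where T' = "dilate (1 / l)"])
    (simp_all add: dilate_polys dilate_dilate dilate_star dilate_add dilate_Cst_mult
      dilate_homogeneous)

lemma binpow_in_graded_auto: "restrict (binpow n c) (polys n) \<in> graded_auto n a"
  by (rule graded_auto_restrictI[where T' = "binpow n (- c)"])
    (simp_all add: binpow_polys binpow_binpow binpow_star binpow_add binpow_Cst_mult
      binpow_homogeneous)

lemma graded_auto_in_polys: "\<sigma> \<in> graded_auto n a \<Longrightarrow> f \<in> polys n \<Longrightarrow> \<sigma> f \<in> polys n"
  using Bij_imp_funcset funcset_mem by (fastforce simp: graded_auto_iff)

lemma graded_autoD:
  assumes "\<sigma> \<in> graded_auto n a"
  shows graded_auto_one: "\<sigma> 1 = 1"
    and graded_auto_star: "f \<in> polys n \<Longrightarrow> g \<in> polys n \<Longrightarrow> \<sigma> (star n a f g) = star n a (\<sigma> f) (\<sigma> g)"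
    and graded_auto_add: "f \<in> polys n \<Longrightarrow> g \<in> polys n \<Longrightarrow> \<sigma> (f + g) = \<sigma> f + \<sigma> g"
    and graded_auto_Cst_mult: "f \<in> polys n \<Longrightarrow> \<sigma> (Cst c * f) = Cst c * \<sigma> f"
    and graded_auto_homogeneous: "f \<in> homogeneous n d \<Longrightarrow> \<sigma> f \<in> homogeneous n d"
  using assms unfolding graded_auto_iff by blast+

lemma graded_auto_compose:
  assumes "\<sigma> \<in> graded_auto n a" "\<tau> \<in> graded_auto n a"
  shows "compose (polys n) \<sigma> \<tau> \<in> graded_auto n a"
proof -
  note assms(2)[THEN graded_auto_in_polys]
  then show ?thesis
    using assms unfolding graded_auto_iff
    by (simp add: compose_Bij compose_eq star_polys polys_add polys_Cst_mult homogeneous_imp_polys)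
qed

lemma polys_linear_ext:
  fixes \<sigma> \<tau> :: "'k::comm_ring_1 mpoly \<Rightarrow> 'k mpoly"
  assumes "\<And>f g. f \<in> polys n \<Longrightarrow> g \<in> polys n \<Longrightarrow> \<sigma> (f + g) = \<sigma> f + \<sigma> g"
    and "\<And>c f. f \<in> polys n \<Longrightarrow> \<sigma> (Cst c * f) = Cst c * \<sigma> f"
    and "\<And>f g. f \<in> polys n \<Longrightarrow> g \<in> polys n \<Longrightarrow> \<tau> (f + g) = \<tau> f + \<tau> g"
    and "\<And>c f. f \<in> polys n \<Longrightarrow> \<tau> (Cst c * f) = Cst c * \<tau> f"
    and "\<And>m. keys m \<subseteq> {0..n} \<Longrightarrow> \<sigma> (single m 1) = \<tau> (single m 1)"
    and "f \<in> polys n"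
  shows "\<sigma> f = \<tau> f"
  using assms(6) unfolding polys_iff[of f n]
proof (induction f rule: poly_mapping_span_induct)
  case zero
  then show ?case
    using assms(2)[of 0 0] assms(4)[of 0 0] by simp
next
  case (add f g)
  then show ?case
    using assms(1,3) by (simp add: polys_iff)
next
  case (single m c)
  then show ?case
    using assms(2,4)[of "single m 1" c] assms(5)[of m] by (simp add: polys_single)
qed

lemma graded_auto_zero: "\<sigma> \<in> graded_auto n a \<Longrightarrow> \<sigma> 0 = 0"
  using graded_auto_Cst_mult[of \<sigma> n a 0 0] by simp

lemma graded_auto_sum:
  assumes "\<sigma> \<in> graded_auto n a" "\<And>i. i \<in> A \<Longrightarrow> f i \<in> polys n"
  shows "\<sigma> (\<Sum>i\<in>A. f i) = (\<Sum>i\<in>A. \<sigma> (f i))"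
  using assms(2)
  by (induction A rule: infinite_finite_induct)
    (simp_all add: graded_auto_add[OF assms(1)] graded_auto_zero[OF assms(1)] polys_sum)

text \<open>The star product of \<open>X i\<close> with a monomial \<open>m\<close> is
  \<open>X i * m\<close> plus multiples of \<open>X (i - l) * m\<close> with \<open>l > 0\<close>.
  This triangular system recovers the commutative product by induction on \<open>i\<close>; every
  monomial is then reached by induction on the degree.\<close>

lemma graded_auto_eqI:
  assumes \<sigma>: "\<sigma> \<in> graded_auto n a" and \<tau>: "\<tau> \<in> graded_auto n a"
    and X: "\<And>i. i \<le> n \<Longrightarrow> \<sigma> (X i) = \<tau> (X i)"
  shows "\<sigma> = \<tau>"
proof (rule extensionalityI)
  show "\<sigma> \<in> extensional (polys n)" "\<tau> \<in> extensional (polys n)"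
    using \<sigma> \<tau> by (simp_all add: graded_auto_iff Bij_def)
next
  have step: "\<sigma> (X i * single m 1) = \<tau> (X i * single m 1)"
    if m: "keys m \<subseteq> {0..n}" "\<sigma> (single m 1) = \<tau> (single m 1)" and "i \<le> n" for i m
    using \<open>i \<le> n\<close>
  proof (induction i rule: less_induct)
    case (less i)
    define w where "w = mwt n a m"
    define S where "S = (\<Sum>l=1..i. Cst (w gchoose l) * (X (i - l) * single m 1))"
    have pol: "X j * single m 1 \<in> polys n" if "j \<le> n" for j
      using that m by (intro polys_mult polys_X polys_single)
    have "{0..i} = insert 0 {1..i}"
      by auto
    then have "star n a (X i) (single m 1) = X i * single m 1 + S"
      using less.prems
      by (simp add: star_single binpow_X S_def w_def sum_distrib_right distrib_right mult.assoc)
    moreover have add_S: "\<rho> (X i * single m 1 + S) = \<rho> (X i * single m 1) + \<rho> S"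
      if "\<rho> \<in> graded_auto n a" for \<rho>
      using less.prems unfolding S_def
      by (intro graded_auto_add[OF that] pol polys_sum polys_Cst_mult) auto
    moreover have "\<sigma> S = \<tau> S"
    proof -
      have "\<rho> S = (\<Sum>l=1..i. Cst (w gchoose l) * \<rho> (X (i - l) * single m 1))"
        if "\<rho> \<in> graded_auto n a" for \<rho>
        using less.prems unfolding S_def
        by (simp add: graded_auto_sum[OF that] graded_auto_Cst_mult[OF that] pol polys_Cst_mult)
      from this[OF \<sigma>] this[OF \<tau>] show ?thesis
        using less.prems by (simp add: less.IH)
    qed
    moreover have "\<sigma> (star n a (X i) (single m 1)) = \<tau> (star n a (X i) (single m 1))"
      using X m less.prems
      by (simp add: graded_auto_star[OF \<sigma>] graded_auto_star[OF \<tau>] polys_X polys_single)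
    ultimately have "\<sigma> (X i * single m 1) + \<sigma> S = \<tau> (X i * single m 1) + \<sigma> S"
      by (simp only: add_S[OF \<sigma>] add_S[OF \<tau>])
    then show ?case
      by (rule add_right_imp_eq)
  qed
  have mono: "\<sigma> (single m 1) = \<tau> (single m 1)" if "keys m \<subseteq> {0..n}" for m
    using that
  proof (induction "mdeg m" arbitrary: m)
    case 0
    then have "m = 0"
      by (intro poly_mapping_eqI) (auto simp: mdeg_def in_keys_iff)
    then show ?case
      by (simp add: graded_auto_one[OF \<sigma>] graded_auto_one[OF \<tau>])
  next
    case (Suc d)
    then obtain i where i: "lookup m i \<noteq> 0"
      by (cases "m = 0") (auto simp: poly_mapping_eq_iff fun_eq_iff)
    with Suc.prems have "i \<le> n"
      by (auto simp: in_keys_iff subset_iff)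
    have "keys (m - var i) \<subseteq> keys m"
      by (auto simp: in_keys_iff lookup_minus)
    moreover have "mdeg (m - var i) = d"
      using Suc.hyps(2) arg_cong[OF minus_var_add[OF i], of mdeg] by (simp add: mdeg_add)
    moreover have "single m 1 = X i * single (m - var i) (1::'a)"
      using minus_var_add[OF i] by (simp add: X_def mult_single add.commute)
    ultimately show ?case
      using step[of "m - var i" i] Suc.hyps(1)[of "m - var i"] Suc.prems \<open>i \<le> n\<close> by simp
  qed
  show "\<sigma> f = \<tau> f" if "f \<in> polys n" for f
    by (rule polys_linear_ext[of n \<sigma> \<tau>])
      (use mono that in \<open>simp_all add: graded_autoD[OF \<sigma>] graded_autoD[OF \<tau>]\<close>)
qed

text \<open>Resolves the definite description: \<open>dilate\<close> provides existence, and
  agreement on the variables provides uniqueness.\<close>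

lemma xi_eq:
  assumes "l \<noteq> 0"
  shows "xi n a l = restrict (dilate l) (polys n)"
  unfolding xi_def
proof (rule the_equality)
  show "\<sigma> = restrict (dilate l) (polys n)"
    if "\<sigma> \<in> graded_auto n a \<and> (\<forall>i\<le>n. \<sigma> (X i) = Cst l * X i)" for \<sigma>
    using that assms
    by (intro graded_auto_eqI[of _ n a]) (simp_all add: dilate_in_graded_auto dilate_X polys_X)
qed (simp add: assms dilate_in_graded_auto dilate_X polys_X)

lemma phi_eq: "phi n a c = restrict (binpow n c) (polys n)"
  unfolding phi_def
proof (rule the_equality)
  show "\<sigma> = restrict (binpow n c) (polys n)"
    if "\<sigma> \<in> graded_auto n a \<and> (\<forall>i\<le>n. \<sigma> (X i) = (\<Sum>l=0..i. Cst (c gchoose l) * X (i - l)))" for \<sigma>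
    using that
    by (intro graded_auto_eqI[of _ n a]) (simp_all add: binpow_in_graded_auto binpow_X polys_X)
qed (simp add: binpow_in_graded_auto binpow_X polys_X)

lemma Aut_gr_simps:
  "carrier (Aut_gr n a) = graded_auto n a"
  "\<sigma> \<in> graded_auto n a \<Longrightarrow> \<tau> \<in> graded_auto n a \<Longrightarrow> \<sigma> \<otimes>\<^bsub>Aut_gr n a\<^esub> \<tau> = compose (polys n) \<sigma> \<tau>"
  by (simp_all add: Aut_gr_def BijGroup_def graded_auto_iff)

lemma xi_mult_phi:
  "l \<noteq> 0 \<Longrightarrow> xi n a l \<otimes>\<^bsub>Aut_gr n a\<^esub> phi n a c = restrict (\<lambda>f. dilate l (binpow n c f)) (polys n)"
  by (auto simp: xi_eq phi_eq Aut_gr_simps dilate_in_graded_auto binpow_in_graded_auto compose_def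
      binpow_polys fun_eq_iff)

subsection \<open>Coefficients of linear and quadratic forms\<close>

definition cf :: "'k::zero mpoly \<Rightarrow> nat \<Rightarrow> 'k" where
  "cf f j = lookup f (var j)"

text \<open>The diagonal entries are doubled, which makes the value on products symmetric in \<open>r\<close> and \<open>s\<close>.\<close>

definition qc :: "nat \<Rightarrow> nat \<Rightarrow> 'k::comm_ring_1 mpoly \<Rightarrow> 'k" where
  "qc r s f = lookup f (var r + var s) * (if r = s then 2 else 1)"

lemma cf_simps [simp]:
  "cf (f + g) j = cf f j + cf g j"
  "cf (Cst c * h) j = c * cf h j"
  "cf 0 j = 0"
  for f g :: "'k::comm_monoid_add mpoly" and h :: "'b::comm_ring_1 mpoly"
  by (simp_all add: cf_def lookup_add)

lemma cf_diff [simp]: "cf (f - g) j = cf f j - cf g j" for f g :: "'k::comm_ring_1 mpoly"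
  by (simp add: cf_def lookup_minus)

lemma cf_sum: "cf (\<Sum>i\<in>A. f i) j = (\<Sum>i\<in>A. cf (f i) j)" for f :: "'a \<Rightarrow> 'k::comm_ring_1 mpoly"
  by (simp add: cf_def lookup_sum)

lemma var_eq_iff [simp]: "var i = var j \<longleftrightarrow> i = j"
proof
  assume "var i = var j"
  then have "lookup (var i) i = lookup (var j) i" by simp
  then show "i = j" by (simp add: lookup_single when_def split: if_splits)
qed simp

lemma cf_X [simp]: "cf (X i) j = (if i = j then 1 else 0)"
  by (simp add: cf_def X_def lookup_single when_def)

lemma qc_simps [simp]:
  "qc r s (f + g) = qc r s f + qc r s g"
  "qc r s (f - g) = qc r s f - qc r s g"
  "qc r s (Cst c * f) = c * qc r s f"
  "qc r s 0 = 0"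
  by (simp_all add: qc_def lookup_add lookup_minus distrib_right left_diff_distrib mult.assoc)

lemma qc_sum: "qc r s (\<Sum>i\<in>A. f i) = (\<Sum>i\<in>A. qc r s (f i))"
  by (induction A rule: infinite_finite_induct) simp_all

lemma var_add_eq_iff: "var p + var q = var r + var s \<longleftrightarrow> p = r \<and> q = s \<or> p = s \<and> q = r"
proof
  assume eq: "var p + var q = var r + var s"
  then have "lookup (var p + var q) p = lookup (var r + var s) p" by simp
  then have "p = r \<or> p = s"
    by (auto simp: lookup_add lookup_single when_def split: if_splits)
  then show "p = r \<and> q = s \<or> p = s \<and> q = r"
    using eq by (auto simp: add.commute[of "var r"])
qed (auto simp: add.commute)

lemma qc_X_X:
  "qc r s (X p * X q) = (if p = r \<and> q = s then 1 else 0) + (if p = s \<and> q = r then 1 else 0)"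
proof -
  have "X p * X q = single (var p + var q) (1::'a)"
    by (simp add: X_def mult_single)
  then show ?thesis
    by (cases "r = s") (simp_all add: qc_def lookup_single when_def var_add_eq_iff)
qed

lemma mdeg_eq_1D:
  assumes "mdeg m = 1"
  obtains i where "m = var i"
proof -
  have "m \<noteq> 0"
    using assms by auto
  then obtain i where i: "lookup m i \<noteq> 0"
    by (auto simp: poly_mapping_eq_iff fun_eq_iff)
  from minus_var_add[OF i] have "mdeg (m - var i) + mdeg (var i) = mdeg m"
    by (simp only: mdeg_add[symmetric])
  with assms have "mdeg (m - var i) = 0"
    by simp
  then have "m - var i = 0"
    by (simp add: mdeg_def poly_mapping_eq_iff fun_eq_iff in_keys_iff)
  then have "m = var i"
    using minus_var_add[OF i] by simp
  then show ?thesis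
    by (rule that)
qed

lemma cf_eq_0: "f \<in> polys n \<Longrightarrow> n < j \<Longrightarrow> cf f j = 0"
  unfolding cf_def polys_iff not_in_keys_iff_lookup_eq_zero[symmetric] by auto

lemma homogeneous_1_expand:
  fixes f :: "'k::comm_ring_1 mpoly"
  assumes "f \<in> homogeneous n 1"
  shows "f = (\<Sum>j=0..n. Cst (cf f j) * X j)"
proof (rule poly_mapping_eqI)
  fix m
  show "lookup f m = lookup (\<Sum>j=0..n. Cst (cf f j) * X j) m"
  proof (cases "\<exists>i. m = var i")
    case True
    then obtain i where i: "m = var i" by blast
    then have "lookup (\<Sum>j=0..n. Cst (cf f j) * X j) m = (\<Sum>j=0..n. if j = i then cf f j else 0)"
      by (simp add: lookup_sum X_def lookup_single when_def if_distrib cong: if_cong)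
    also have "\<dots> = cf f i"
      using cf_eq_0[OF homogeneous_imp_polys[OF assms], of i] by (auto simp: sum.delta)
    finally show ?thesis
      by (simp add: i cf_def)
  next
    case False
    then have "mdeg m \<noteq> 1"
      by (blast elim: mdeg_eq_1D)
    with assms have "m \<notin> keys f"
      by (auto simp: homogeneous_iff)
    then have "lookup f m = 0"
      by (simp add: in_keys_iff)
    moreover have "lookup (Cst (cf f j) * X j) m = 0" for j
      using False by (auto simp: X_def lookup_single when_def)
    ultimately show ?thesis
      by (simp add: lookup_sum)
  qed
qed

lemma homogeneous_1_eqI:
  fixes f g :: "'k::comm_ring_1 mpoly"
  assumes "f \<in> homogeneous n 1" "g \<in> homogeneous n 1" "\<And>j. j \<le> n \<Longrightarrow> cf f j = cf g j"
  shows "f = g"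
proof -
  have "f = (\<Sum>j=0..n. Cst (cf f j) * X j)"
    by (rule homogeneous_1_expand) (rule assms(1))
  also have "\<dots> = (\<Sum>j=0..n. Cst (cf g j) * X j)"
    using assms(3) by simp
  also have "\<dots> = g"
    by (rule homogeneous_1_expand[symmetric]) (rule assms(2))
  finally show ?thesis .
qed

lemma qc_mult_X:
  fixes h :: "'k::comm_ring_1 mpoly"
  assumes "h \<in> homogeneous n 1"
  shows "qc r s (h * X j) = (if j = s then cf h r else 0) + (if j = r then cf h s else 0)"
proof -
  have [simp]: "(\<Sum>p=0..n. if p = i then cf h p else 0) = cf h i" for i
    using cf_eq_0[OF homogeneous_imp_polys[OF assms], of i] by (auto simp: sum.delta)
  have "qc r s (h * X j) = qc r s (\<Sum>p=0..n. Cst (cf h p) * (X p * X j))"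
    by (subst homogeneous_1_expand[OF assms]) (simp add: sum_distrib_right mult.assoc)
  also have "\<dots> = (\<Sum>p=0..n. (if j = s then if p = r then cf h p else 0 else 0)
      + (if j = r then if p = s then cf h p else 0 else 0))"
    unfolding qc_sum by (intro sum.cong) (auto simp: qc_X_X)
  finally show ?thesis
    by (auto simp: sum.distrib)
qed

lemma qc_X_0_mult:
  fixes h :: "'k::comm_ring_1 mpoly"
  assumes "h \<in> homogeneous n 1"
  shows "qc r s (X 0 * h) = (if s = 0 then cf h r else 0) + (if r = 0 then cf h s else 0)"
  unfolding mult.commute[of "X 0" h] qc_mult_X[OF assms] by (cases "r = 0"; cases "s = 0") simp_all

text \<open>Since \<open>X j\<close> on the right has weight \<open>a + j\<close>, only the terms
  \<open>X s\<close> and \<open>X r\<close> of \<open>g\<close> contribute to the monomial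
  \<open>X r * X s\<close>, each with its own power of \<open>1 + Delta\<close>.\<close>

lemma qc_star:
  assumes "f \<in> homogeneous n 1" "g \<in> homogeneous n 1"
  shows "qc r s (star n a f g)
    = cf g s * cf (binpow n (a + of_nat s) f) r + cf g r * cf (binpow n (a + of_nat r) f) s"
proof -
  have [simp]: "(\<Sum>p=0..n. if p = i then cf g p * F p else 0) = cf g i * F i" for i F
    using cf_eq_0[OF homogeneous_imp_polys[OF assms(2)], of i] by (auto simp: sum.delta)
  have "qc r s (star n a f g) = qc r s (\<Sum>j=0..n. Cst (cf g j) * (binpow n (a + of_nat j) f * X j))"
    by (subst homogeneous_1_expand[OF assms(2)])
      (simp add: star_sum_right star_Cst_mult_right star_X)
  also have "\<dots> = (\<Sum>j=0..n. (if j = s then cf g j * cf (binpow n (a + of_nat j) f) r else 0)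
     + (if j = r then cf g j * cf (binpow n (a + of_nat j) f) s else 0))"
    unfolding qc_sum
    by (intro sum.cong) (auto simp: qc_mult_X[OF binpow_homogeneous[OF assms(1)]] distrib_left)
  finally show ?thesis
    by (simp add: sum.distrib)
qed

lemma Delta_sum: "Delta n (\<Sum>i\<in>A. f i) = (\<Sum>i\<in>A. Delta n (f i))"
  by (induction A rule: infinite_finite_induct) (simp_all add: Delta_add)

lemma Delta_homogeneous: "f \<in> homogeneous n d \<Longrightarrow> Delta n f \<in> homogeneous n d"
  unfolding homogeneous_iff
  by (rule keys_Delta_subset) (simp_all add: keys_shift_subset mdeg_shift)

text \<open>On linear forms \<open>Delta\<close> is the left shift of the coefficient
  sequence.\<close>

lemma cf_Delta:
  fixes f :: "'k::comm_ring_1 mpoly"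
  assumes "f \<in> homogeneous n 1"
  shows "cf (Delta n f) r = cf f (Suc r)"
proof -
  have "cf (Delta n f) r = (\<Sum>j=0..n. cf f j * cf (Delta n (X j)) r)"
    by (subst homogeneous_1_expand[OF assms]) (simp add: Delta_sum Delta_Cst_mult cf_sum)
  also have "\<dots> = (\<Sum>j=0..n. if j = Suc r then cf f j else 0)"
    by (intro sum.cong) (auto simp: Delta_X)
  also have "\<dots> = cf f (Suc r)"
    using cf_eq_0[OF homogeneous_imp_polys[OF assms], of "Suc r"] by (auto simp: sum.delta)
  finally show ?thesis .
qed

lemma Delta_pow_homogeneous_1:
  fixes f :: "'k::comm_ring_1 mpoly"
  assumes "f \<in> homogeneous n 1"
  shows "(Delta n ^^ k) f \<in> homogeneous n 1 \<and> (\<forall>r. cf ((Delta n ^^ k) f) r = cf f (r + k))"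
  using assms by (induction k) (simp_all add: Delta_homogeneous cf_Delta)

lemma homogeneous_zero [simp]: "0 \<in> homogeneous n d"
  by (simp add: homogeneous_iff)

lemma cf_binpow:
  assumes "f \<in> homogeneous n 1"
  shows "cf (binpow n c f) r = (\<Sum>k=0..n. (c gchoose k) * cf f (r + k))"
proof -
  have "(Delta n ^^ k) f = 0" if "k \<ge> Suc n" for k
    using that Delta_pow_homogeneous_1[OF assms, of k] cf_eq_0[OF homogeneous_imp_polys[OF assms]]
    by (intro homogeneous_1_eqI[of _ n]) auto
  then have "binpow n c f = (\<Sum>k<Suc n. Cst (c gchoose k) * (Delta n ^^ k) f)"
    by (rule binpow_eq_sum)
  then show ?thesis
    using Delta_pow_homogeneous_1[OF assms]
    by (simp only: cf_sum cf_simps lessThan_Suc_atMost atLeast0AtMost)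
qed

lemma cf_binpow_beyond:
  assumes "f \<in> homogeneous n 1" "\<And>j. j > r \<Longrightarrow> cf f j = 0"
  shows "cf (binpow n c f) r = cf f r"
proof -
  have "cf (binpow n c f) r = (\<Sum>k=0..n. if k = 0 then cf f r else 0)"
    unfolding cf_binpow[OF assms(1)] using assms(2) by (intro sum.cong) auto
  then show ?thesis by simp
qed

text \<open>Just below the top index the exponent \<open>c\<close> becomes visible, and it enters
  linearly; at the top index itself the power acts trivially.\<close>

lemma cf_binpow_second:
  assumes "f \<in> homogeneous n 1" "\<And>j. j > Suc r \<Longrightarrow> cf f j = 0"
  shows "cf (binpow n c f) r = cf f r + c * cf f (Suc r)"
proof -
  have "cf (binpow n c f) r
      = (\<Sum>k=0..n. (if k = 0 then cf f r else 0) + (if k = 1 then c * cf f (Suc r) else 0))"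
    unfolding cf_binpow[OF assms(1)] using assms(2) by (intro sum.cong) auto
  also have "\<dots> = cf f r + (if 1 \<le> n then c * cf f (Suc r) else 0)"
    by (simp add: sum.distrib sum.delta)
  finally show ?thesis
    using cf_eq_0[OF homogeneous_imp_polys[OF assms(1)], of "Suc r"] by auto
qed

lemma cf_binpow_1:
  assumes "f \<in> homogeneous n 1"
  shows "cf (binpow n 1 f) r = cf f r + cf f (Suc r)"
  using binpow_plus_1[of n 0 f] by (simp add: cf_Delta[OF assms])

lemma cf_binpow_X: "i \<le> n \<Longrightarrow> cf (binpow n c (X i)) r = (if r \<le> i then c gchoose (i - r) else 0)"
proof -
  assume "i \<le> n"
  then have "cf (binpow n c (X i)) r = (\<Sum>l=0..i. if i - l = r then c gchoose l else 0)"
    by (simp add: binpow_X cf_sum if_distrib cong: if_cong)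
  also have "\<dots> = (\<Sum>l=0..i. if l = i - r then if r \<le> i then c gchoose l else 0 else 0)"
    by (intro sum.cong) auto
  finally show ?thesis
    by (simp add: sum.delta)
qed

text \<open>The cutoff \<open>k\<close> encodes working modulo the variables with smaller
  index.\<close>

lemma ex_top_index:
  assumes "f \<in> polys n" "j \<ge> k" "cf f j \<noteq> 0"
  obtains r where "r \<ge> k" "cf f r \<noteq> 0" "\<And>i. i > r \<Longrightarrow> cf f i = 0"
proof -
  define A where "A = {j. k \<le> j \<and> cf f j \<noteq> 0}"
  have fin: "finite A"
    by (rule finite_subset[of _ "{..n}"]) (use cf_eq_0[OF assms(1)] in \<open>auto simp: A_def not_less[symmetric]\<close>)
  have "A \<noteq> {}"
    using assms by (auto simp: A_def)
  with fin have Max: "Max A \<in> A"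
    by (rule Max_in)
  show ?thesis
  proof (rule that)
    show "k \<le> Max A" "cf f (Max A) \<noteq> 0"
      using Max by (simp_all add: A_def)
    show "cf f i = 0" if "Max A < i" for i
      using that Max_ge[OF fin, of i] \<open>k \<le> Max A\<close> by (force simp: A_def)
  qed
qed

text \<open>
  Read modulo the variables with index below \<open>k\<close>, the hypothesis is the relation
  \<open>X k * p = p * u\<close> in the algebra, so \<open>p\<close> is a normal element there.
\<close>

lemma normal_linear_form:
  fixes p u :: "'k::field_char_0 mpoly"
  assumes p: "p \<in> homogeneous n 1" and u: "u \<in> homogeneous n 1"
    and eq: "\<And>r s. k \<le> r \<Longrightarrow> k \<le> s \<Longrightarrow>
      (if r = k then cf p s else 0) + (if s = k then cf p r else 0)
        = cf u s * cf (binpow n (a + of_nat s) p) r + cf u r * cf (binpow n (a + of_nat r) p) s"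
    and nz: "i \<ge> k" "cf p i \<noteq> 0" "j \<ge> k" "cf u j \<noteq> 0" "a + of_nat k \<noteq> 0"
    and s: "s > k"
  shows "cf p s = 0"
proof -
  obtain r where r: "r \<ge> k" "cf p r \<noteq> 0" "\<And>i. i > r \<Longrightarrow> cf p i = 0"
    using ex_top_index[OF homogeneous_imp_polys[OF p] nz(1,2)] by blast
  obtain t where t: "t \<ge> k" "cf u t \<noteq> 0" "\<And>i. i > t \<Longrightarrow> cf u i = 0"
    using ex_top_index[OF homogeneous_imp_polys[OF u] nz(3,4)] by blast
  have top: "cf (binpow n c p) r = cf p r" for c
    by (rule cf_binpow_beyond[OF p r(3)])
  have beyond: "cf (binpow n c p) i = 0" if "i > r" for c i
    using that r(3) by (subst cf_binpow_beyond[OF p]) auto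
  have "r = k"
  proof (rule ccontr)
    assume "r \<noteq> k"
    with r(1) have "r > k" by simp
    show False
    proof (cases "t = k")
      case False
      \<comment> \<open>Away from index \<open>k\<close> the left side is zero, but the right side
        at \<open>X r * X t\<close> is \<open>cf u t * cf p r\<close>, doubled if
        \<open>t = r\<close>.\<close>
      consider "t > r" | "t = r" | "t < r" by linarith
      then show False
        using eq[OF r(1) t(1)] False \<open>r > k\<close> r(2) t top beyond by cases auto
    next
      case True
      \<comment> \<open>Now \<open>u\<close> is a multiple of \<open>X k\<close> modulo lower
        variables. The top coefficient forces the scalar to be 1, and the next coefficient then
        exposes the nonzero weight \<open>a + k\<close>.\<close>
      have "cf p r = cf u k * cf p r"
        using eq[OF _ r(1), of k] \<open>r > k\<close> t(3) True top by simp
      then have uk: "cf u k = 1"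
        using r(2) by simp
      obtain q where q: "r = Suc q"
        using \<open>r > k\<close> by (cases r) auto
      have second: "cf (binpow n c p) q = cf p q + c * cf p r" for c
        unfolding q by (rule cf_binpow_second[OF p]) (use r(3) q in auto)
      have "(a + of_nat k) * cf p r = 0"
      proof (cases "q = k")
        case True
        \<comment> \<open>When \<open>q = k\<close> the comparison is at a square, where both sides
          of the equation come doubled.\<close>
        define d where "d = (a + of_nat k) * cf p r"
        have B: "cf (binpow n (a + of_nat k) p) k = cf p k + d"
          unfolding d_def using second[of "a + of_nat k"] by (simp only: True)
        have "cf p k + cf p k = (cf p k + d) + (cf p k + d)"
          using eq[of k k] unfolding uk B by simp
        then have "d + d = 0"
          by (simp add: algebra_simps)
        then have "2 * d = 0"
          by (simp only: mult_2)
        then show ?thesis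
          by (simp add: d_def)
      next
        case False
        with q \<open>r > k\<close> have "q > k"
          by simp
        then have "cf u q = 0"
          using t(3) \<open>t = k\<close> by simp
        moreover have "cf (binpow n (a + of_nat k) p) q = cf p q + (a + of_nat k) * cf p r"
          by (rule second)
        ultimately show ?thesis
          using eq[of k q] \<open>q > k\<close> uk by simp
      qed
      then show False
        using nz(5) r(2) by simp
    qed
  qed
  with s r(3) show ?thesis by simp
qed

subsection \<open>Graded automorphisms on linear forms\<close>

definition hcomp :: "nat \<Rightarrow> 'k::comm_ring_1 mpoly \<Rightarrow> 'k mpoly" where
  "hcomp d f = (\<Sum>m\<in>{m \<in> keys f. mdeg m = d}. single m (lookup f m))"

lemma lookup_hcomp: "lookup (hcomp d f) m = (if mdeg m = d then lookup f m else 0)"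
  by (simp add: hcomp_def lookup_sum lookup_single when_def in_keys_iff)

lemma hcomp_add: "hcomp d (f + g) = hcomp d f + hcomp d g"
  by (rule poly_mapping_eqI) (simp add: lookup_hcomp lookup_add)

lemma hcomp_Cst_mult: "hcomp d (Cst c * f) = Cst c * hcomp d f"
  by (rule poly_mapping_eqI) (simp add: lookup_hcomp)

lemma hcomp_homogeneous:
  assumes "f \<in> homogeneous n e"
  shows "hcomp d f = (if e = d then f else 0)"
proof (rule poly_mapping_eqI)
  fix m
  have "mdeg m = e" if "lookup f m \<noteq> 0"
    using assms that unfolding homogeneous_iff lookup_not_eq_zero_eq_in_keys by blast
  then show "lookup (hcomp d f) m = lookup (if e = d then f else 0) m"
    by (cases "lookup f m = 0") (simp_all add: lookup_hcomp)
qed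

lemma hcomp_in_homogeneous: "f \<in> polys n \<Longrightarrow> hcomp d f \<in> homogeneous n d"
proof -
  assume f: "f \<in> polys n"
  have "keys (hcomp d f) \<subseteq> {m \<in> keys f. mdeg m = d}"
    by (auto simp: in_keys_iff lookup_hcomp split: if_splits)
  also have "\<dots> \<subseteq> {m. keys m \<subseteq> {0..n} \<and> mdeg m = d}"
    using f unfolding polys_iff by blast
  finally show ?thesis
    by (simp only: homogeneous_iff)
qed

lemma graded_auto_hcomp:
  assumes \<sigma>: "\<sigma> \<in> graded_auto n a" and "f \<in> polys n"
  shows "\<sigma> (hcomp d f) = hcomp d (\<sigma> f)"
proof (rule polys_linear_ext[where \<sigma> = "\<lambda>f. \<sigma> (hcomp d f)" and \<tau> = "\<lambda>f. hcomp d (\<sigma> f)", OF _ _ _ _ _ assms(2)])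
  fix m :: "nat \<Rightarrow>\<^sub>0 nat"
  assume "keys m \<subseteq> {0..n}"
  then have m: "single m (1::'a) \<in> homogeneous n (mdeg m)"
    by (simp add: homogeneous_iff)
  show "\<sigma> (hcomp d (single m 1)) = hcomp d (\<sigma> (single m 1))"
    unfolding hcomp_homogeneous[OF m] hcomp_homogeneous[OF graded_auto_homogeneous[OF \<sigma> m]]
    by (simp add: graded_auto_zero[OF \<sigma>])
next
  fix f g :: "'a mpoly" and c
  assume f: "f \<in> polys n" and g: "g \<in> polys n"
  note pol = f g homogeneous_imp_polys[OF hcomp_in_homogeneous]
  show "\<sigma> (hcomp d (f + g)) = \<sigma> (hcomp d f) + \<sigma> (hcomp d g)"
    by (simp add: hcomp_add graded_auto_add[OF \<sigma>] pol)
  show "hcomp d (\<sigma> (f + g)) = hcomp d (\<sigma> f) + hcomp d (\<sigma> g)"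
    by (simp add: hcomp_add graded_auto_add[OF \<sigma>] pol)
next
  fix f :: "'a mpoly" and c
  assume f: "f \<in> polys n"
  note pol = f homogeneous_imp_polys[OF hcomp_in_homogeneous]
  show "\<sigma> (hcomp d (Cst c * f)) = Cst c * \<sigma> (hcomp d f)"
    by (simp add: hcomp_Cst_mult graded_auto_Cst_mult[OF \<sigma>] pol)
  show "hcomp d (\<sigma> (Cst c * f)) = Cst c * hcomp d (\<sigma> f)"
    by (simp add: hcomp_Cst_mult graded_auto_Cst_mult[OF \<sigma>] pol)
qed

text \<open>The grading condition only gives inclusion of images. An arbitrary preimage is projected
  to degree \<open>d\<close>, and the projection commutes with \<sigma>.\<close>

lemma graded_auto_surj_homogeneous:
  assumes \<sigma>: "\<sigma> \<in> graded_auto n a" and f: "f \<in> homogeneous n d"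
  obtains g where "g \<in> homogeneous n d" "\<sigma> g = f"
proof -
  have "bij_betw \<sigma> (polys n) (polys n)"
    using \<sigma> by (simp add: graded_auto_iff Bij_def)
  then obtain g where g: "g \<in> polys n" "\<sigma> g = f"
    using homogeneous_imp_polys[OF f] unfolding bij_betw_def by (metis imageE)
  have "\<sigma> (hcomp d g) = f"
    using graded_auto_hcomp[OF \<sigma> g(1), of d] hcomp_homogeneous[OF f, of d] g(2) by simp
  then show ?thesis
    using that hcomp_in_homogeneous[OF g(1)] by blast
qed

lemma graded_auto_inj:
  assumes "\<sigma> \<in> graded_auto n a" "f \<in> polys n" "g \<in> polys n" "\<sigma> f = \<sigma> g"
  shows "f = g"
proof -
  have "inj_on \<sigma> (polys n)"
    using assms(1) by (simp add: graded_auto_iff Bij_def bij_betw_def)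
  then show ?thesis
    by (rule inj_onD[OF _ assms(4,2,3)])
qed

lemma homogeneous_diff:
  fixes f g :: "'k::comm_ring_1 mpoly"
  assumes "f \<in> homogeneous n d" "g \<in> homogeneous n d"
  shows "f - g \<in> homogeneous n d"
proof -
  have "f - g = f + Cst (- 1) * g"
    by (simp add: Cst_uminus)
  then show ?thesis
    by (simp only: homogeneous_add homogeneous_Cst_mult assms)
qed

lemma keys_Gam: "keys (Gam n a f) \<subseteq> keys f"
proof -
  have "lookup (Gam n a f) m = mwt n a m * lookup f m" for m
    by (induction f rule: poly_mapping_add_induct)
      (simp_all add: Gam_add lookup_add distrib_left Gam_single lookup_single when_def)
  then show ?thesis
    by (auto simp: in_keys_iff)
qed

lemma Gam_homogeneous: "f \<in> homogeneous n d \<Longrightarrow> Gam n a f \<in> homogeneous n d"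
  unfolding homogeneous_iff by (rule order.trans[OF keys_Gam])

lemma cf_Gam: "j \<le> n \<Longrightarrow> cf (Gam n a f) j = (a + of_nat j) * cf f j"
proof -
  assume j: "j \<le> n"
  have "lookup (Gam n a f) (var j) = mwt n a (var j) * lookup f (var j)"
    by (induction f rule: poly_mapping_add_induct)
      (simp_all add: Gam_add lookup_add distrib_left Gam_single lookup_single when_def)
  then show ?thesis
    by (simp add: cf_def mwt_var[OF j])
qed

lemma X_ne_0 [simp]: "(X i :: 'k::field_char_0 mpoly) \<noteq> 0"
  using cf_X[of i i] by (metis cf_simps(3) zero_neq_one)

lemma homogeneous_1_eq_X_0:
  fixes f :: "'k::comm_ring_1 mpoly"
  assumes "f \<in> homogeneous n 1" "\<And>j. j > 0 \<Longrightarrow> cf f j = 0"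
  shows "f = Cst (cf f 0) * X 0"
  using assms by (intro homogeneous_1_eqI[of _ n]) (auto intro!: homogeneous_Cst_mult homogeneous_X[of 0 n, simplified])

lemma homogeneous_1_nonzeroE:
  fixes f :: "'k::comm_ring_1 mpoly"
  assumes "f \<in> homogeneous n 1" "f \<noteq> 0"
  obtains i where "cf f i \<noteq> 0"
proof -
  have "\<exists>i. cf f i \<noteq> 0"
  proof (rule ccontr)
    assume "\<not> ?thesis"
    then have "f = 0"
      by (intro homogeneous_1_eqI[OF assms(1) homogeneous_zero]) simp
    with assms(2) show False by simp
  qed
  then show ?thesis
    using that by blast
qed

section \<open>Commutation relations for \<open>X 0\<close> and \<open>X 1\<close>\<close>

lemma binpow_X_0: "binpow n c (X 0) = X 0"
  by (simp add: binpow_X)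

lemma binpow_X_1: "n \<ge> 1 \<Longrightarrow> binpow n c (X 1) = X 1 + Cst c * X 0"
  by (simp add: binpow_X)

lemma star_X_0: "star n a v (X 0) = binpow n a v * X 0"
  using star_X[of 0 n a v] by simp

text \<open>Normality of \<open>X 0\<close>, with \<open>(1 + Delta)^a\<close> as the commutation
  twist; centrality when \<open>a = 0\<close>.\<close>

lemma star_X_0_right: "star n a v (X 0) = star n a (X 0) (binpow n a v)"
  by (simp add: star_X_0 star_X_0_left mult.commute)

text \<open>With \<open>u = binpow n (a + 1) v\<close>, both sides equal
  \<open>X 1 * u + X 0 * Gam n a u\<close>. The correction makes \<open>X 1\<close> normal modulo
  \<open>X 0\<close>.\<close>

lemma star_X_1_right:
  assumes "n \<ge> 1"
  shows "star n a v (X 1) + star n a (X 0) (Gam n a (binpow n (a + 1) v))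
    = star n a (X 1) (binpow n (a + 1) v)"
  unfolding star_X_1_left[OF assms] star_X_0_left star_X[OF assms] by (simp add: mult.commute)

text \<open>If the top index were positive, the coefficient just below it would change by
  \<open>c\<close> times the top coefficient.\<close>

lemma binpow_fixed:
  fixes f :: "'k::field_char_0 mpoly"
  assumes f: "f \<in> homogeneous n 1" and fixed: "binpow n c f = f" and "c \<noteq> 0"
  shows "f = Cst (cf f 0) * X 0"
proof (rule homogeneous_1_eq_X_0[OF f], rule ccontr)
  fix j :: nat
  assume "j > 0" "cf f j \<noteq> 0"
  then have "1 \<le> j"
    by simp
  then obtain r where r: "r \<ge> 1" "cf f r \<noteq> 0" "\<And>i. i > r \<Longrightarrow> cf f i = 0"
    using ex_top_index[OF homogeneous_imp_polys[OF f] _ \<open>cf f j \<noteq> 0\<close>, of 1] by blast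
  obtain q where q: "r = Suc q"
    using r(1) by (cases r) auto
  have "cf (binpow n c f) q = cf f q + c * cf f (Suc q)"
    by (rule cf_binpow_second[OF f]) (use r(3) q in auto)
  then show False
    using r(2) \<open>c \<noteq> 0\<close> by (simp add: fixed q)
qed

lemma graded_auto_X_0:
  fixes a :: "'k::field_char_0"
  assumes \<sigma>: "\<sigma> \<in> graded_auto n a" and na: "n \<ge> 2 \<or> (n = 1 \<and> a \<noteq> 0)"
  obtains l where "l \<noteq> 0" "\<sigma> (X 0) = Cst l * X 0"
proof -
  have X0: "(X 0 :: 'k mpoly) \<in> homogeneous n 1"
    by (rule homogeneous_X) simp
  define p where "p = \<sigma> (X 0)"
  have p: "p \<in> homogeneous n 1"
    unfolding p_def by (rule graded_auto_homogeneous[OF \<sigma> X0])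
  have "p \<noteq> 0"
    using graded_auto_inj[OF \<sigma> homogeneous_imp_polys[OF X0] polys_zero] graded_auto_zero[OF \<sigma>]
    by (auto simp: p_def)
  then obtain i where i: "cf p i \<noteq> 0"
    by (rule homogeneous_1_nonzeroE[OF p])
  have "cf p j = 0" if "j > 0" for j
  proof (cases "a = 0")
    case False
    \<comment> \<open>Applying \<sigma> to the normality relation for this preimage of
      \<open>X 0\<close> yields a relation with \<open>X 0\<close> on one side and \<open>p\<close>
      on both.\<close>
    obtain g where g: "g \<in> homogeneous n 1" "\<sigma> g = X 0"
      using graded_auto_surj_homogeneous[OF \<sigma> X0] by blast
    define u where "u = \<sigma> (binpow n a g)"
    have u: "u \<in> homogeneous n 1"
      unfolding u_def by (rule graded_auto_homogeneous[OF \<sigma> binpow_homogeneous[OF g(1)]])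
    have "\<sigma> (star n a g (X 0)) = \<sigma> (star n a (X 0) (binpow n a g))"
      by (simp only: star_X_0_right)
    then have rel: "star n a (X 0) p = star n a p u"
      by (simp add: graded_auto_star[OF \<sigma>] homogeneous_imp_polys[OF X0] homogeneous_imp_polys[OF g(1)]
          binpow_polys g(2) p_def u_def)
    have "X 0 * p \<noteq> 0"
      using \<open>p \<noteq> 0\<close> by simp
    then have "u \<noteq> 0"
      using rel by (auto simp: star_X_0_left)
    then obtain t where t: "cf u t \<noteq> 0"
      by (rule homogeneous_1_nonzeroE[OF u])
    have "(if r = 0 then cf p s else 0) + (if s = 0 then cf p r else 0)
        = cf u s * cf (binpow n (a + of_nat s) p) r + cf u r * cf (binpow n (a + of_nat r) p) s" for r s
      using arg_cong[OF rel, of "qc r s"] unfolding qc_star[OF p u] star_X_0_left qc_X_0_mult[OF p]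
      by (simp add: add.commute)
    then show ?thesis
      using False i t that by (intro normal_linear_form[OF p u, of 0 a i t j]) simp_all
  next
    case True
    with na have n: "1 \<le> n" "2 \<le> n" by auto
    \<comment> \<open>Every linear form has a linear preimage, so \<open>p\<close> inherits
      commutation with all linear forms from \<open>X 0\<close>.\<close>
    have central: "star n a v p = star n a p v" if v: "v \<in> homogeneous n 1" for v
    proof -
      obtain g where g: "g \<in> homogeneous n 1" "\<sigma> g = v"
        using graded_auto_surj_homogeneous[OF \<sigma> v] by blast
      have "\<sigma> (star n a g (X 0)) = \<sigma> (star n a (X 0) g)"
        by (simp only: star_X_0_right[of n a g]) (simp add: True)
      then show ?thesis
        by (simp add: graded_auto_star[OF \<sigma>] homogeneous_imp_polys[OF X0]
            homogeneous_imp_polys[OF g(1)] g(2) p_def)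
    qed
    have high: "cf p s = 0" if "s \<ge> 2" for s
    proof -
      note X1 = homogeneous_X[OF n(1)]
      have "cf p s * of_nat s = 0"
        using arg_cong[OF central[OF X1], of "qc 0 s"] that
        unfolding qc_star[OF X1 p] qc_star[OF p X1] by (simp add: cf_binpow_X[OF n(1), simplified] True)
      with that show ?thesis by simp
    qed
    note X2 = homogeneous_X[OF n(2)]
    \<comment> \<open>\<open>X 0\<close> and \<open>X 1\<close> commute when \<open>a = 0\<close>,
      so testing against \<open>X 1\<close> cannot see this coefficient. Against \<open>X 2\<close>
      it appears at \<open>X 1 * X 1\<close>, since \<open>Delta\<close> sends \<open>X 2\<close> to
      \<open>X 1\<close> and \<open>X 1\<close> has weight 1; this uses
      \<open>2 \<le> n\<close>.\<close>
    have "cf p 1 = 0"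
      using arg_cong[OF central[OF X2], of "qc 1 1"]
      unfolding qc_star[OF X2 p] qc_star[OF p X2] by (simp add: cf_binpow_X[OF n(2)] True)
    then show ?thesis
      using high[of j] that by (cases "j = 1") auto
  qed
  then have pe: "p = Cst (cf p 0) * X 0"
    by (rule homogeneous_1_eq_X_0[OF p])
  with \<open>p \<noteq> 0\<close> have "cf p 0 \<noteq> 0"
    by (metis Cst_simps(1) mult_zero_left)
  then show ?thesis
    using pe unfolding p_def by (rule that)
qed

lemma graded_auto_X_1:
  fixes a :: "'k::field_char_0"
  assumes \<sigma>: "\<sigma> \<in> graded_auto n a" and na: "n \<ge> 2 \<or> (n = 1 \<and> a \<noteq> 0)"
    and \<sigma>X0: "\<sigma> (X 0) = X 0"
  obtains c where "\<sigma> (X 1) = X 1 + Cst c * X 0"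
proof -
  have n: "1 \<le> n"
    using na by auto
  have X0: "(X 0 :: 'k mpoly) \<in> homogeneous n 1"
    by (rule homogeneous_X) simp
  note X1 = homogeneous_X[OF n]
  define q where "q = \<sigma> (X 1)"
  have q: "q \<in> homogeneous n 1"
    unfolding q_def by (rule graded_auto_homogeneous[OF \<sigma> X1])
  have \<sigma>c0: "\<sigma> (Cst c * X 0) = Cst c * X 0" for c
    by (simp add: graded_auto_Cst_mult[OF \<sigma> homogeneous_imp_polys[OF X0]] \<sigma>X0)
  show ?thesis
  proof (cases "a = 0")
    case False
    \<comment> \<open>The image of this relation is an affine equation for \<open>q\<close> that
      \<open>X 1\<close> also solves. Their difference is fixed by \<open>(1 + Delta)^a\<close>,
      hence a multiple of \<open>X 0\<close>.\<close>
    have "star n a (X 1) (X 0) = star n a (X 0) (X 1 + Cst a * X 0)"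
      by (simp only: star_X_0_right[of n a "X 1"] binpow_X_1[OF n])
    then have "\<sigma> (star n a (X 1) (X 0)) = \<sigma> (star n a (X 0) (X 1 + Cst a * X 0))"
      by simp
    then have "star n a q (X 0) = star n a (X 0) (q + Cst a * X 0)"
      by (simp add: graded_auto_star[OF \<sigma>] graded_auto_add[OF \<sigma>] homogeneous_imp_polys[OF X0]
          homogeneous_imp_polys[OF X1, simplified] polys_add polys_Cst_mult \<sigma>X0 \<sigma>c0 q_def)
    then have "X 0 * binpow n a q = X 0 * (q + Cst a * X 0)"
      by (simp only: star_X_0 star_X_0_left mult.commute)
    then have bq: "binpow n a q = q + Cst a * X 0"
      by (simp only: mult_left_cancel[OF X_ne_0])
    have h: "q - X 1 \<in> homogeneous n 1"
      by (rule homogeneous_diff[OF q X1])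
    have "binpow n a (q - X 1 + X 1) = binpow n a (q - X 1) + binpow n a (X 1)"
      by (rule binpow_add)
    then have "binpow n a (q - X 1) + X 1 = q"
      unfolding binpow_X_1[OF n] by (simp add: bq)
    then have "binpow n a (q - X 1) = q - X 1"
      by (simp only: eq_diff_eq)
    from binpow_fixed[OF h this False] have "q = X 1 + Cst (cf (q - X 1) 0) * X 0"
      by (metis add.commute diff_add_cancel)
    then show ?thesis
      unfolding q_def by (rule that)
  next
    case True
    with na have n2: "2 \<le> n" by auto
    note X2 = homogeneous_X[OF n2]
    obtain g where g: "g \<in> homogeneous n 1" "\<sigma> g = X 1"
      using graded_auto_surj_homogeneous[OF \<sigma> X1] by blast
    \<comment> \<open>The exponent is \<open>a + 1\<close> at \<open>a = 0\<close>.\<close>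
    define u' where "u' = binpow n 1 g"
    have u': "u' \<in> homogeneous n 1"
      unfolding u'_def by (rule binpow_homogeneous[OF g(1)])
    define u where "u = \<sigma> u'"
    define z where "z = \<sigma> (Gam n a u')"
    have u: "u \<in> homogeneous n 1" and z: "z \<in> homogeneous n 1"
      unfolding u_def z_def by (intro graded_auto_homogeneous[OF \<sigma>] u' Gam_homogeneous)+
    have "\<sigma> (star n a g (X 1) + star n a (X 0) (Gam n a u')) = \<sigma> (star n a (X 1) u')"
      using star_X_1_right[OF n, of a g] True by (simp add: u'_def)
    moreover note pols = homogeneous_imp_polys[OF X0] homogeneous_imp_polys[OF X1]
      homogeneous_imp_polys[OF g(1)] homogeneous_imp_polys[OF u']
      homogeneous_imp_polys[OF Gam_homogeneous[OF u']]
    ultimately have rel: "star n a (X 1) q + X 0 * z = star n a q u"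
      unfolding graded_auto_add[OF \<sigma> star_polys[OF pols(3,2)] star_polys[OF pols(1,5)]]
        graded_auto_star[OF \<sigma> pols(3,2)] graded_auto_star[OF \<sigma> pols(1,5)]
        graded_auto_star[OF \<sigma> pols(2,4)] g(2) \<sigma>X0
      by (simp only: star_X_0_left flip: q_def u_def z_def)
    have not_X0: "X 1 \<noteq> Cst c * (X 0 :: 'k mpoly)" for c
    proof
      assume "X 1 = Cst c * (X 0 :: 'k mpoly)"
      then have "cf (X 1 :: 'k mpoly) 1 = cf (Cst c * X 0) 1" by simp
      then show False by simp
    qed
    have "\<exists>i\<ge>1. cf q i \<noteq> 0"
    proof (rule ccontr)
      assume "\<not> ?thesis"
      then have "q = Cst (cf q 0) * X 0"
        by (intro homogeneous_1_eq_X_0[OF q]) auto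
      then have "\<sigma> (X 1) = \<sigma> (Cst (cf q 0) * X 0)"
        unfolding \<sigma>c0 q_def[symmetric] .
      then show False
        using graded_auto_inj[OF \<sigma> pols(2) polys_Cst_mult[OF pols(1)]] not_X0 by blast
    qed
    then obtain i where i: "i \<ge> 1" "cf q i \<noteq> 0" by blast
    \<comment> \<open>Otherwise \<open>u'\<close> is a multiple of \<open>X 0\<close>, hence so is
      \<open>g\<close> because powers of \<open>1 + Delta\<close> fix \<open>X 0\<close>, and
      \<sigma> could not send \<open>g\<close> to \<open>X 1\<close>.\<close>
    have "\<exists>j\<ge>1. cf u j \<noteq> 0"
    proof (rule ccontr)
      assume "\<not> ?thesis"
      then have "u = Cst (cf u 0) * X 0"
        by (intro homogeneous_1_eq_X_0[OF u]) auto
      then have "\<sigma> u' = \<sigma> (Cst (cf u 0) * X 0)"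
        unfolding \<sigma>c0 u_def[symmetric] .
      then have "u' = Cst (cf u 0) * X 0"
        by (rule graded_auto_inj[OF \<sigma> pols(4) polys_Cst_mult[OF pols(1)]])
      then have "binpow n (- 1) u' = Cst (cf u 0) * X 0"
        by (simp only: binpow_Cst_mult binpow_X_0)
      then have "g = Cst (cf u 0) * X 0"
        by (simp add: u'_def binpow_binpow)
      then have "\<sigma> g = Cst (cf u 0) * X 0"
        by (simp only: \<sigma>c0)
      then show False
        using g(2) not_X0[of "cf u 0"] by metis
    qed
    then obtain j where j: "j \<ge> 1" "cf u j \<noteq> 0" by blast
    have "(if r = 1 then cf q s else 0) + (if s = 1 then cf q r else 0)
        = cf u s * cf (binpow n (a + of_nat s) q) r + cf u r * cf (binpow n (a + of_nat r) q) s"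
      if "1 \<le> r" "1 \<le> s" for r s
      using arg_cong[OF rel, of "qc r s"] that
      unfolding qc_star[OF q u] qc_simps qc_star[OF X1 q] qc_X_0_mult[OF z]
      by (cases "r = 1"; cases "s = 1") (simp_all add: cf_binpow_X[OF n, simplified])
    then have high: "cf q s = 0" if "s > 1" for s
      using True i j that by (intro normal_linear_form[OF q u, of 1 a i j s]) simp_all
    \<comment> \<open>It remains to show that \<open>q\<close> has coefficient 1 at
      \<open>X 1\<close>. The scale comes from the \<open>X 1\<close> relation with
      \<open>v = X 2\<close>, where \<open>Gam\<close> has the distinct eigenvalues 2 and 1 on
      \<open>X 2\<close> and \<open>X 1\<close>.\<close>
    define t where "t = \<sigma> (X 2)"
    have t: "t \<in> homogeneous n 1"
      unfolding t_def by (rule graded_auto_homogeneous[OF \<sigma> X2])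
    have bX2: "binpow n 1 (X 2 :: 'k mpoly) = X 2 + X 1"
      using binpow_plus_1[of n 0 "X 2"] by (simp add: Delta_X[OF n2])
    define y where "y = Cst 2 * X 2 + (X 1 :: 'k mpoly)"
    have "Gam n a (X 2 + X 1) = y"
      using Gam_X[OF n2, of a] Gam_X[OF n, of a] by (simp add: y_def Gam_add True)
    then have "star n a (X 2) (X 1) + star n a (X 0) y = star n a (X 1) (X 2 + X 1)"
      using star_X_1_right[OF n, of a "X 2"] True by (simp add: bX2)
    then have rel1: "\<sigma> (star n a (X 2) (X 1) + star n a (X 0) y) = \<sigma> (star n a (X 1) (X 2 + X 1))"
      by simp
    note pols2 = pols(1,2) homogeneous_imp_polys[OF X2]
    have y: "y \<in> polys n"
      unfolding y_def by (intro polys_add polys_Cst_mult pols2)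
    have \<sigma>y: "\<sigma> y = Cst 2 * t + q"
      unfolding y_def t_def q_def
      by (simp only: graded_auto_add[OF \<sigma>] graded_auto_Cst_mult[OF \<sigma>] polys_Cst_mult pols2)
    have \<sigma>21: "\<sigma> (X 2 + X 1) = t + q"
      unfolding t_def q_def by (simp only: graded_auto_add[OF \<sigma>] pols2)
    note pols3 = star_polys[OF pols2(3,2)] star_polys[OF pols2(1) y] polys_add[OF pols2(3,2)]
    from rel1 have rel2: "star n a t q + X 0 * (Cst 2 * t + q) = star n a q (t + q)"
      unfolding graded_auto_add[OF \<sigma> pols3(1,2)] graded_auto_star[OF \<sigma> pols2(3,2)]
        graded_auto_star[OF \<sigma> pols2(1) y] graded_auto_star[OF \<sigma> pols2(2) pols3(3)] \<sigma>y \<sigma>21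
      unfolding \<sigma>X0 star_X_0_left q_def t_def .
    have tq: "t + q \<in> homogeneous n 1" and y': "Cst 2 * t + q \<in> homogeneous n 1"
      by (intro homogeneous_add homogeneous_Cst_mult t q)+
    have cq: "cf (binpow n c q) 1 = cf q 1" "cf (binpow n c q) 2 = 0"
      "cf (binpow n c q) 0 = cf q 0 + c * cf q 1" for c
      using high cf_binpow_beyond[OF q, of 1] cf_binpow_beyond[OF q, of 2] cf_binpow_second[OF q, of 0]
      by auto
    have q1: "cf q 1 \<noteq> 0"
      using i high[of i] by (cases "i = 1") auto
    \<comment> \<open>The square of \<open>X 1\<close> shows that \<open>X 2\<close> and
      \<open>X 1\<close> are scaled alike; the monomial \<open>X 0 * X 2\<close> below then fixes
      the common scale.\<close>
    have "2 * (cf q 1 * (cf t 1 + cf t 2)) = 2 * ((cf t 1 + cf q 1) * cf q 1)"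
      using arg_cong[OF rel2, of "qc 1 1"]
      unfolding qc_simps qc_star[OF t q] qc_star[OF q tq] qc_X_0_mult[OF y']
      by (simp add: True cq[simplified] cf_binpow_1[OF t] numeral_2_eq_2)
    then have "cf q 1 * (cf t 1 + cf t 2) = (cf t 1 + cf q 1) * cf q 1"
      by (simp only: mult_cancel_left) simp
    then have "cf q 1 * cf t 2 = cf q 1 * cf q 1"
      by (simp add: algebra_simps)
    then have t2: "cf t 2 = cf q 1"
      using q1 by simp
    have "cf q 0 * cf t 2 + 2 * cf t 2 = cf t 2 * (cf q 0 + 2 * cf q 1)"
      using arg_cong[OF rel2, of "qc 0 2"] high[of 2]
      unfolding qc_simps qc_star[OF t q] qc_star[OF q tq] qc_X_0_mult[OF y']
      by (simp add: True cq)
    then have "2 * cf q 1 * (cf q 1 - 1) = 0"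
      by (simp add: t2 algebra_simps)
    then have "cf q 1 = 1"
      using q1 by simp
    then have "cf q j = cf (X 1 + Cst (cf q 0) * X 0) j" for j
      using high[of j] by (cases "j = 0"; cases "j = 1") auto
    then have "q = X 1 + Cst (cf q 0) * X 0"
      by (rule homogeneous_1_eqI[OF q homogeneous_add[OF X1 homogeneous_Cst_mult[OF X0]]])
    then show ?thesis
      unfolding q_def by (rule that)
  qed
qed

lemma graded_auto_fixes_span:
  fixes h :: "'k::field_char_0 mpoly"
  assumes \<sigma>: "\<sigma> \<in> graded_auto n a" and h: "h \<in> homogeneous n 1"
    and "\<And>j. j \<ge> i \<Longrightarrow> cf h j = 0" and "\<And>j. j < i \<Longrightarrow> j \<le> n \<Longrightarrow> \<sigma> (X j) = X j"
  shows "\<sigma> h = h"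
proof -
  have fix_term: "\<sigma> (Cst (cf h j) * X j) = Cst (cf h j) * X j" if "j \<le> n" for j
    using assms(3,4)[of j] that graded_auto_zero[OF \<sigma>] graded_auto_Cst_mult[OF \<sigma> polys_X]
    by (cases "j < i") simp_all
  have "\<sigma> h = \<sigma> (\<Sum>j=0..n. Cst (cf h j) * X j)"
    by (subst homogeneous_1_expand[OF h]) (rule refl)
  also have "\<dots> = (\<Sum>j=0..n. \<sigma> (Cst (cf h j) * X j))"
    by (rule graded_auto_sum[OF \<sigma>]) (simp add: polys_Cst_mult polys_X)
  also have "\<dots> = (\<Sum>j=0..n. Cst (cf h j) * X j)"
    using fix_term by simp
  also have "\<dots> = h"
    by (rule homogeneous_1_expand[OF h, symmetric])
  finally show ?thesis .
qed

text \<open>With \<open>t\<close> the defect at \<open>X i\<close>, the lower terms of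
  \<open>(1 + Delta)^c (X i)\<close> are fixed by induction and cancel. Two homogeneous linear
  conditions on \<open>t\<close> remain: invariance under \<open>(1 + Delta)^a\<close>, and a
  relation with \<open>X 1\<close> in which \<open>Gam\<close> has become the scalar
  \<open>a + i\<close>.\<close>

lemma graded_auto_fixes_variables:
  fixes a :: "'k::field_char_0"
  assumes \<sigma>: "\<sigma> \<in> graded_auto n a" and na: "n \<ge> 2 \<or> (n = 1 \<and> a \<noteq> 0)"
    and fix0: "\<sigma> (X 0) = X 0" and fix1: "\<sigma> (X 1) = X 1"
  shows "i \<le> n \<Longrightarrow> \<sigma> (X i) = X i"
proof (induction i rule: less_induct)
  case (less i)
  show ?case
  proof (cases "i < 2")
    case True
    then show ?thesis
      using fix0 fix1 by (auto simp: less_2_cases_iff)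
  next
    case False
    have n: "1 \<le> n"
      using na by auto
    have X0: "(X 0 :: 'k mpoly) \<in> homogeneous n 1"
      by (rule homogeneous_X) simp
    note X1 = homogeneous_X[OF n]
    note Xi = homogeneous_X[OF less.prems]
    note pols = homogeneous_imp_polys[OF X0] homogeneous_imp_polys[OF X1] homogeneous_imp_polys[OF Xi]
    define t where "t = \<sigma> (X i) - X i"
    have \<sigma>Xi: "\<sigma> (X i) = t + X i"
      by (simp add: t_def)
    have t: "t \<in> homogeneous n 1"
      unfolding t_def by (intro homogeneous_diff graded_auto_homogeneous[OF \<sigma> Xi] Xi)
    define w where "w c = binpow n c (X i) - (X i :: 'k mpoly)" for c
    have b: "binpow n c (X i) = X i + w c" for c
      by (simp add: w_def)
    have w: "w c \<in> homogeneous n 1" for c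
      unfolding w_def by (intro homogeneous_diff binpow_homogeneous Xi)
    have cw: "cf (w c) j = 0" if "j \<ge> i" for j c
      using that by (simp add: w_def cf_binpow_X[OF less.prems])
    have \<sigma>w: "\<sigma> (w c) = w c" for c
      by (rule graded_auto_fixes_span[OF \<sigma> w cw]) (use less.IH in auto)
    have cGw: "cf (Gam n a (w c)) j = 0" if "j \<ge> i" for j c
      using that cw[of j] cf_Gam[of j n a "w c"]
        cf_eq_0[OF homogeneous_imp_polys[OF Gam_homogeneous[OF w]], of j]
      by (cases "j \<le> n") auto
    have \<sigma>Gw: "\<sigma> (Gam n a (w c)) = Gam n a (w c)" for c
      by (rule graded_auto_fixes_span[OF \<sigma> Gam_homogeneous[OF w] cGw]) (use less.IH in auto)
    note pols' = pols homogeneous_imp_polys[OF w] homogeneous_imp_polys[OF Gam_homogeneous[OF w]]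
    have X0_mult: "\<sigma> (X 0 * f) = X 0 * \<sigma> f" if "f \<in> polys n" for f
      using graded_auto_star[OF \<sigma> pols(1) that] by (simp only: star_X_0_left fix0)
    have t_a: "binpow n a t = t"
    proof -
      have "\<sigma> (star n a (X i) (X 0)) = \<sigma> (X 0 * (X i + w a))"
        by (simp only: star_X_0 b mult.commute)
      then have "star n a (t + X i) (X 0) = X 0 * (t + X i + w a)"
        by (simp only: graded_auto_star[OF \<sigma>] pols' X0_mult graded_auto_add[OF \<sigma>] polys_add \<sigma>w \<sigma>Xi fix0)
      then have "X 0 * binpow n a (t + X i) = X 0 * (t + X i + w a)"
        by (simp only: star_X_0 mult.commute)
      then have "binpow n a (t + X i) = t + X i + w a"
        by (simp only: mult_left_cancel[OF X_ne_0])
      then show ?thesis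
        by (simp add: binpow_add b)
    qed
    have rel: "star n a t (X 1) + X 0 * (Cst (a + of_nat i) * t) = star n a (X 1) t"
    proof -
      define v where "v = w (a + 1)"
      have Gu: "Gam n a (X i + v) = Cst (a + of_nat i) * X i + Gam n a v"
        by (simp only: Gam_add Gam_X[OF less.prems])
      have id: "star n a (X i) (X 1) + X 0 * (Cst (a + of_nat i) * X i + Gam n a v) = star n a (X 1) (X i + v)"
        using star_X_1_right[OF n, of a "X i"] by (simp only: b v_def[symmetric] Gu star_X_0_left)
      then have "\<sigma> (star n a (X i) (X 1) + X 0 * (Cst (a + of_nat i) * X i + Gam n a v))
          = \<sigma> (star n a (X 1) (X i + v))"
        by simp
      then have "star n a (t + X i) (X 1) + X 0 * (Cst (a + of_nat i) * (t + X i) + Gam n a v)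
          = star n a (X 1) (t + X i + v)"
        by (simp only: graded_auto_add[OF \<sigma>] graded_auto_star[OF \<sigma>] graded_auto_Cst_mult[OF \<sigma>] X0_mult
            pols' polys_add polys_mult star_polys polys_Cst_mult \<sigma>w \<sigma>Gw \<sigma>Xi fix0 fix1 v_def)
      then have "(star n a t (X 1) + X 0 * (Cst (a + of_nat i) * t))
            + (star n a (X i) (X 1) + X 0 * (Cst (a + of_nat i) * X i + Gam n a v))
          = star n a (X 1) t + star n a (X 1) (X i + v)"
        by (simp only: star_add_left star_add_right distrib_left add_ac)
      then show ?thesis
        unfolding id by (rule add_right_imp_eq)
    qed
    note y = homogeneous_Cst_mult[OF t, of "a + of_nat i"]
    have rel_qc: "qc r s (star n a t (X 1)) + qc r s (X 0 * (Cst (a + of_nat i) * t)) = qc r s (star n a (X 1) t)"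
      for r s
      using arg_cong[OF rel, of "qc r s"] by (simp only: qc_simps)
    note rel_qc = rel_qc[unfolded qc_star[OF t X1] qc_star[OF X1 t] qc_X_0_mult[OF y]]
    \<comment> \<open>At the square of \<open>X 0\<close> the relation compares the scalar
      \<open>a + i\<close> with the weight \<open>a\<close> of \<open>X 0\<close>.\<close>
    have "(a + of_nat i) * cf t 0 + (a + of_nat i) * cf t 0 = cf t 0 * a + cf t 0 * a"
      using rel_qc[of 0 0] by (simp add: cf_binpow_X[OF n, simplified])
    then have "2 * (of_nat i * cf t 0) = 0"
      by (simp add: algebra_simps)
    then have t0: "cf t 0 = 0"
      using False by simp
    have "cf t j = 0" if "j \<le> n" for j
    proof (cases "a = 0")
      case False
      from binpow_fixed[OF t t_a this] t0 have "t = 0"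
        by simp
      then show ?thesis by simp
    next
      case True
      \<comment> \<open>Invariance under \<open>(1 + Delta)^a\<close> is void for
        \<open>a = 0\<close>. The monomial \<open>X 0 * X s\<close> compares the scalar
        \<open>i\<close> with the weight \<open>s\<close>, leaving index \<open>i\<close>
        undecided.\<close>
      have high: "cf t s = 0" if "s \<ge> 2" "s \<noteq> i" for s
      proof -
        have "of_nat i * cf t s = cf t s * of_nat s"
          using rel_qc[of 0 s] that by (simp add: cf_binpow_X[OF n, simplified] True)
        then have "(of_nat i - of_nat s) * cf t s = 0"
          by (simp add: algebra_simps)
        with that show ?thesis by simp
      qed
      obtain k where k: "i = Suc k" "k \<ge> 1"
        using \<open>\<not> i < 2\<close> by (cases i) auto
      \<comment> \<open>At \<open>X 1 * X (i - 1)\<close> the factor \<open>(1 + Delta)\<close>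
        acting on \<open>t\<close> brings down the coefficient of index \<open>i\<close>. For
        \<open>i = 2\<close> this monomial is a square and the equation is doubled.\<close>
      have "cf t i = 0"
      proof (cases "k = 1")
        case True
        have "2 * (cf t 1 + cf t 2) = 2 * cf t 1"
          using rel_qc[of 1 1] \<open>a = 0\<close>
          by (simp add: cf_binpow_X[OF n, simplified] cf_binpow_1[OF t] numeral_2_eq_2)
        then have "cf t 2 = 0"
          by (simp add: algebra_simps)
        with True k show ?thesis
          by (simp add: numeral_2_eq_2)
      next
        case False
        with k have "k \<ge> 2" "k \<noteq> i" by auto
        with rel_qc[of 1 k] \<open>a = 0\<close> high[of k] k show ?thesis
          by (simp add: cf_binpow_X[OF n, simplified] cf_binpow_1[OF t])
      qed
      moreover have "of_nat i * cf t 1 = 0"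
        using rel_qc[of 0 1] True t0
        by (simp add: cf_binpow_X[OF n, simplified] cf_binpow_1[OF t])
      then have "cf t 1 = 0"
        using \<open>\<not> i < 2\<close> by simp
      ultimately show ?thesis
        using high[of j] t0 by (cases "j = i"; cases "j = 0"; cases "j = 1") auto
    qed
    then have "t = 0"
      by (intro homogeneous_1_eqI[OF t homogeneous_zero]) simp
    then show ?thesis
      by (simp add: \<sigma>Xi)
  qed
qed

lemma graded_auto_eq_dilate_binpow:
  fixes a :: "'k::field_char_0"
  assumes \<sigma>: "\<sigma> \<in> graded_auto n a" and na: "n \<ge> 2 \<or> (n = 1 \<and> a \<noteq> 0)"
  obtains l c where "l \<noteq> 0" "\<And>f. f \<in> polys n \<Longrightarrow> \<sigma> f = dilate l (binpow n c f)"
proof -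
  have n: "1 \<le> n"
    using na by auto
  have X0: "(X 0 :: 'k mpoly) \<in> polys n" and X1: "(X 1 :: 'k mpoly) \<in> polys n"
    using polys_X n by auto
  obtain l where l: "l \<noteq> 0" "\<sigma> (X 0) = Cst l * X 0"
    by (rule graded_auto_X_0[OF \<sigma> na])
  define \<tau> where "\<tau> = compose (polys n) (restrict (dilate (1 / l)) (polys n)) \<sigma>"
  have \<tau>_eq: "\<tau> f = dilate (1 / l) (\<sigma> f)" if "f \<in> polys n" for f
    using that graded_auto_in_polys[OF \<sigma> that] by (simp add: \<tau>_def compose_eq)
  have \<tau>: "\<tau> \<in> graded_auto n a"
    unfolding \<tau>_def using l(1) by (intro graded_auto_compose dilate_in_graded_auto \<sigma>) simp
  have \<tau>X0: "\<tau> (X 0) = X 0"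
    using l by (simp add: \<tau>_eq[OF X0] dilate_Cst_mult dilate_X)
  obtain c where c: "\<tau> (X 1) = X 1 + Cst c * X 0"
    by (rule graded_auto_X_1[OF \<tau> na \<tau>X0])
  define \<rho> where "\<rho> = compose (polys n) (restrict (binpow n (- c)) (polys n)) \<tau>"
  have \<rho>_eq: "\<rho> f = binpow n (- c) (\<tau> f)" if "f \<in> polys n" for f
    using that graded_auto_in_polys[OF \<tau> that] by (simp add: \<rho>_def compose_eq)
  have \<rho>: "\<rho> \<in> graded_auto n a"
    unfolding \<rho>_def by (intro graded_auto_compose binpow_in_graded_auto \<tau>)
  have "\<rho> (X 0) = X 0"
    by (simp add: \<rho>_eq[OF X0] \<tau>X0 binpow_X_0)
  moreover have "\<rho> (X 1) = X 1"
    unfolding \<rho>_eq[OF X1] c binpow_add binpow_Cst_mult binpow_X_0 binpow_X_1[OF n]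
    by (simp add: Cst_uminus)
  ultimately have "\<rho> (X i) = X i" if "i \<le> n" for i
    using graded_auto_fixes_variables[OF \<rho> na _ _ that] by blast
  \<comment> \<open>The identity is written as \<open>binpow n 0\<close> because that map is already
    known to be a graded automorphism.\<close>
  then have "\<rho> = restrict (binpow n 0) (polys n)"
    by (intro graded_auto_eqI[OF \<rho> binpow_in_graded_auto]) (simp add: polys_X)
  then have \<rho>_id: "\<rho> f = f" if "f \<in> polys n" for f
    using that by simp
  have "\<sigma> f = dilate l (binpow n c f)" if "f \<in> polys n" for f
  proof -
    have "binpow n c (\<rho> f) = \<tau> f"
      unfolding \<rho>_eq[OF that] binpow_binpow by simp
    then have "dilate l (binpow n c f) = dilate l (\<tau> f)"
      by (simp only: \<rho>_id[OF that])
    also have "\<dots> = \<sigma> f"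
      using l(1) by (simp add: \<tau>_eq[OF that] dilate_dilate)
    finally show ?thesis by simp
  qed
  with l(1) show ?thesis
    by (rule that)
qed

section \<open>The scalar groups and the isomorphism\<close>

lemma group_mult_group: "group (mult_group :: 'k::field monoid)"
proof (rule groupI)
  fix x :: 'k
  assume "x \<in> carrier mult_group"
  then show "\<exists>y\<in>carrier mult_group. y \<otimes>\<^bsub>mult_group\<^esub> x = \<one>\<^bsub>mult_group\<^esub>"
    by (intro bexI[of _ "inverse x"]) (simp_all add: mult_group_def)
qed (simp_all add: mult_group_def)

lemma group_add_group: "group (add_group :: 'k::field monoid)"
proof (rule groupI)
  fix x :: 'k
  show "\<exists>y\<in>carrier add_group. y \<otimes>\<^bsub>add_group\<^esub> x = \<one>\<^bsub>add_group\<^esub>"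
    by (intro bexI[of _ "- x"]) (simp_all add: add_group_def)
qed (simp_all add: add_group_def add.assoc)

theorem theorem4p10:
  fixes n :: nat and a :: "'k::field_char_0"
  assumes "n \<ge> 2 \<or> (n = 1 \<and> a \<noteq> 0)"
  shows "(\<forall>\<sigma> \<in> carrier (Aut_gr n a). \<exists>l c. l \<noteq> 0 \<and> \<sigma> = xi n a l \<otimes>\<^bsub>Aut_gr n a\<^esub> phi n a c)
       \<and> Aut_gr n a \<cong> (mult_group :: 'k monoid) \<times>\<times> (add_group :: 'k monoid)"
proof
  let ?P = "(mult_group :: 'k monoid) \<times>\<times> (add_group :: 'k monoid)"
  have n: "1 \<le> n"
    using assms by auto
  define F :: "'k \<times> 'k \<Rightarrow> 'k mpoly \<Rightarrow> 'k mpoly" where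
    "F = (\<lambda>(l, c). restrict (\<lambda>f. dilate l (binpow n c f)) (polys n))"
  have F_mult: "F (l, c) = xi n a l \<otimes>\<^bsub>Aut_gr n a\<^esub> phi n a c" if "l \<noteq> 0" for l c
    using xi_mult_phi[OF that] by (simp add: F_def)
  have F_in: "F (l, c) \<in> graded_auto n a" if "l \<noteq> 0" for l c
    unfolding F_mult[OF that]
    by (simp add: xi_eq that phi_eq Aut_gr_simps graded_auto_compose dilate_in_graded_auto binpow_in_graded_auto)
  have F_surj: "\<exists>l c. l \<noteq> 0 \<and> \<sigma> = F (l, c)" if \<sigma>: "\<sigma> \<in> graded_auto n a" for \<sigma>
  proof -
    obtain l c where l: "l \<noteq> 0" "\<And>f. f \<in> polys n \<Longrightarrow> \<sigma> f = dilate l (binpow n c f)"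
      using graded_auto_eq_dilate_binpow[OF \<sigma> assms] by blast
    have "\<sigma> \<in> extensional (polys n)"
      using \<sigma> by (simp add: graded_auto_iff Bij_def)
    then have "\<sigma> = F (l, c)"
      unfolding F_def using l(2) by (intro extensionalityI[of _ "polys n"]) simp_all
    with l(1) show ?thesis by blast
  qed
  show "\<forall>\<sigma> \<in> carrier (Aut_gr n a). \<exists>l c. l \<noteq> 0 \<and> \<sigma> = xi n a l \<otimes>\<^bsub>Aut_gr n a\<^esub> phi n a c"
    using F_surj F_mult unfolding Aut_gr_simps by metis
  have carr: "carrier ?P = {l::'k. l \<noteq> 0} \<times> UNIV"
    by (simp add: DirProd_def mult_group_def add_group_def)
  have "F \<in> iso ?P (Aut_gr n a)"
  proof (rule isoI)
    show "F \<in> hom ?P (Aut_gr n a)"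
    proof (rule homI)
      fix x y
      assume "x \<in> carrier ?P" "y \<in> carrier ?P"
      then obtain l c l' c' where xy: "x = (l, c)" "l \<noteq> 0" "y = (l', c')" "l' \<noteq> 0"
        unfolding carr by auto
      then show "F x \<in> carrier (Aut_gr n a)"
        using F_in by (simp add: Aut_gr_simps)
      \<comment> \<open>Dilations commute with powers of \<open>1 + Delta\<close>, so the parameters
        combine independently.\<close>
      have "compose (polys n) (F (l, c)) (F (l', c')) = F (l * l', c + c')"
        by (rule extensionalityI[of _ "polys n"])
          (simp_all add: F_def compose_def dilate_polys binpow_polys dilate_dilate binpow_binpow
            flip: dilate_binpow)
      then show "F (x \<otimes>\<^bsub>?P\<^esub> y) = F x \<otimes>\<^bsub>Aut_gr n a\<^esub> F y"
        using xy F_in by (simp add: Aut_gr_simps DirProd_def mult_group_def add_group_def)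
    qed
    have X1: "(X 1 :: 'k mpoly) \<in> polys n"
      by (rule polys_X[OF n])
    \<comment> \<open>The image of \<open>X 1\<close> determines both parameters: its coefficients
      are \<open>l\<close> at \<open>X 1\<close> and \<open>c * l\<close> at
      \<open>X 0\<close>.\<close>
    have "(l, c) = (l', c')" if "F (l, c) = F (l', c')" "l \<noteq> 0" for l c l' c'
    proof -
      have "dilate l (binpow n c (X 1)) = dilate l' (binpow n c' (X 1))"
        using fun_cong[OF that(1), of "X 1"] X1 by (simp add: F_def)
      then have eq: "Cst l * X 1 + Cst (c * l) * X 0 = Cst l' * X 1 + Cst (c' * l') * (X 0 :: 'k mpoly)"
        unfolding binpow_X_1[OF n] dilate_add dilate_Cst_mult dilate_X by simp
      show ?thesis
        using arg_cong[OF eq, of "\<lambda>f. cf f 1"] arg_cong[OF eq, of "\<lambda>f. cf f 0"] that(2) by simp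
    qed
    then have "inj_on F ({l. l \<noteq> 0} \<times> UNIV)"
      by (auto simp: inj_on_def)
    moreover have "F ` ({l. l \<noteq> 0} \<times> UNIV) = graded_auto n a"
    proof
      show "F ` ({l. l \<noteq> 0} \<times> UNIV) \<subseteq> graded_auto n a"
        using F_in by (simp add: image_subset_iff)
      show "graded_auto n a \<subseteq> F ` ({l. l \<noteq> 0} \<times> UNIV)"
      proof
        fix \<sigma>
        assume "\<sigma> \<in> graded_auto n a"
        then obtain l c where "l \<noteq> 0" "\<sigma> = F (l, c)"
          using F_surj by blast
        then show "\<sigma> \<in> F ` ({l. l \<noteq> 0} \<times> UNIV)"
          by simp
      qed
    qed
    ultimately show "bij_betw F (carrier ?P) (carrier (Aut_gr n a))"
      unfolding carr Aut_gr_simps by (simp add: bij_betw_def)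
  qed
  then have "?P \<cong> Aut_gr n a"
    by (rule is_isoI)
  \<comment> \<open>The map starts at the product because \<open>group.iso_sym\<close> asks for the
    group axioms of the source, which are immediate there.\<close>
  then show "Aut_gr n a \<cong> ?P"
    using group.iso_sym[OF DirProd_group[OF group_mult_group group_add_group]] by blast
qed

end
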